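(* The $(\mathcal I(2),\mathcal I(2))$-bimodule $\widetilde{\mathcal X}^{DA}$ with the operations listed in the context is a valid $DA$ bimodule over $(\mathcal B(2),\mathcal B(2))$, and it is homotopy equivalent to the $DA$ bimodule $\mathcal X^{DA}$.
   Context: Let $\mathbb F=\mathbb F_2$. **The algebra $\mathcal B(2)$.** $\mathcal B(2)$ is the $\mathbb F$-path algebra of the following quiver modulo relations. Vertices: all subsets $\mathbf x\subset\{0,1,2\}$. For $i\in\{1,2\}$: an arrow $R_i$ from $\mathbf x$ to $(\mathbf x\setminus\{i-1\})\cup\{i\}$ whenever $\mathbf x\cap\{i-1,i\}=\{i-1\}$; an arrow $L_i$ from $\mathbf x$ to $(\mathbf x\setminus\{i\})\cup\{i-1\}$ whenever $\mathbf x\cap\{i-1,i\}=\{i\}$; a loop $U_i$ at every $\mathbf x$. Paths are multiplied left to right: an arrow from $\mathbf x$ to $\mathbf y$ is an element of $\mathbf I_{\mathbf x}\mathcal B(2)\mathbf I_{\mathbf y}$ (left idempotent $\mathbf I_{\mathbf x}$, right idempotent $\mathbf I_{\mathbf y}$), where $\mathbf I_{\mathbf x}$ is the trivial path at $\mathbf x$. Relations, wherever composable: $U_i$ commutes with all labels; $R_iL_i=U_i$; $L_iR_i=U_i$; $R_1R_2=0$; $L_2L_1=0$; and $U_i=0$ at $\mathbf x$ if $\mathbf x\cap\{i-1,i\}=\varnothing$. $\mathcal I(2)$ is the subring spanned by the $\mathbf I_{\mathbf x}$. The differential of $\mathcal B(2)$ is zero. $\mathcal B(2)=\bigoplus_{k=0}^3\mathcal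 B(2,k)$, where $\mathcal B(2,k)$ is the part with $|\mathbf x|=k$. Write $A=\{0\},B=\{1\},C=\{2\},AB=\{0,1\},AC=\{0,2\},BC=\{1,2\},ABC=\{0,1,2\}$. $\mathcal B(2)$ has homological degree $0$ and Alexander degree in $\mathbb Z^4=\mathbb Z\langle\tau_1,\beta_1,\tau_2,\beta_2\rangle$ given by $R_i\mapsto\tau_i$, $L_i\mapsto\beta_i$, $U_i\mapsto\tau_i+\beta_i$. Let $\mathcal B(2)_+$ be the kernel of the augmentation $\mathcal B(2)\to\mathcal I(2)$ sending all $R_i,L_i,U_i$ to $0$. Basis of $\mathcal B(2)$ used to specify operations ($i,j\ge0$): $k=0$: $\mathbf I_\varnothing$. $k=1$: from $A$ to $A$: $U_1^i$; $A$ to $B$: $R_1U_1^i$; $B$ to $A$: $L_1U_1^i$; $B$ to $B$: $\mathbf I_B$, $U_1^{i+1}$, $U_2^{i+1}$; $B$ to $C$: $R_2U_2^i$; $C$ to $B$: $L_2U_2^i$; $C$ to $C$: $U_2^i$; none between $A$ and $C$. $k=2$: $pU_1^iU_2^j$, where $p$ is: the idempotent (each vertex to itself); $R_2$ ($AB$ to $AC$); $R_2R_1$ ($AB$ to $BC$); $L_2$ ($AC$ to $AB$); $R_1$ ($AC$ to $BC$); $L_1L_2$ ($BC$ to $AB$); $L_1$ ($BC$ to $AC$). $k=3$: $U_1^iU_2^j$. **$DA$ bimodules.** A $DA$ bimodule over $(\mathcal B(2),\mathcal B(2))$ (whose differentials vanish) is a $\mathbb Z\oplus\mathbb Z^4$-graded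 (left, right) $(\mathcal I(2),\mathcal I(2))$-bimodule $X$ with, for $i\ge1$, $(\mathcal I(2),\mathcal I(2))$-bilinear maps $\delta^1_i:X\otimes\mathcal B(2)^{\otimes(i-1)}\to\mathcal B(2)\otimes X$ (tensor products over $\mathcal I(2)$) which preserve the Alexander ($\mathbb Z^4$) degree and change the homological ($\mathbb Z$) degree by $2-i$, such that for all $i\ge1$ $$\sum_{j=1}^i(\mu\otimes\mathrm{id})\circ(\mathrm{id}\otimes\delta^1_{i-j+1})\circ(\delta^1_j\otimes\mathrm{id})+\sum_{j=1}^{i-2}\delta^1_{i-1}\circ(\mathrm{id}\otimes\mu_{j,j+1})=0,$$ where $\mu$ is multiplication and $\mu_{j,j+1}$ multiplies the $j$-th and $(j+1)$-st algebra inputs. **Homotopy equivalence.** A $DA$ morphism $f:X\to Y$ of degree $k$ is a collection of bilinear maps $f_i:X\otimes(\mathcal B(2)_+)^{\otimes(i-1)}\to\mathcal B(2)\otimes Y$, $i\ge1$, preserving the Alexander degree and changing the homological degree by $k+1-i$. Its differential is $$(\partial f)_i=\sum_{j=1}^i(\mu\otimes\mathrm{id})(\mathrm{id}\otimes\delta^1_{i-j+1})(f_j\otimes\mathrm{id})+\sum_{j=1}^i(\mu\otimes\mathrm{id})(\mathrm{id}\otimes f_{i-j+1})(\delta^1_j\otimes\mathrm{id})+\sum_{j=1}^{i-2}f_{i-1}(\mathrm{id}\otimes\mu_{j,j+1}),$$ and composition is $(g\circ f)_i=\sum_{j=1}^i(\mu\otimes\mathrm{id})(\mathrm{id}\otimes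 g_{i-j+1})(f_j\otimes\mathrm{id})$. The identity morphism has $\mathrm{id}_1(x)=1\otimes x$ and $\mathrm{id}_i=0$ for $i>1$. $X$ and $Y$ are homotopy equivalent if there are degree-$0$ morphisms $f:X\to Y$, $g:Y\to X$ with $\partial f=0$, $\partial g=0$ and degree $-1$ morphisms $h,h'$ with $g\circ f+\mathrm{id}=\partial h$, $f\circ g+\mathrm{id}=\partial h'$. **The bimodule $\mathcal X^{DA}$.** It has the following $\mathbb F$-basis; "$(\mathbf x|\mathbf y)$" means left idempotent $\mathbf I_{\mathbf x}$ and right idempotent $\mathbf I_{\mathbf y}$, and each basis element has a type among $S^\pm_t,S^\pm_b,W_t,W_b,E_t,E_b$. * Over $\mathcal B(2,0)$: $z_1=S^-_t,\ z_2=S^-_b,\ z_3=S^+_b,\ z_4=S^+_t$, all $(\varnothing|\varnothing)$. * Over $\mathcal B(2,1)$: $x_1=S^-_t\,(A|A)$, $x_2=S^-_t\,(C|C)$, $x_3=W_t\,(B|A)$, $x_4=S^-_b\,(A|A)$, $x_5=S^-_b\,(C|C)$, $x_6=E_b\,(B|C)$, $x_7=W_b\,(B|A)$, $x_8=S^+_b\,(A|A)$, $x_9=S^+_b\,(C|C)$, $x_{10}=E_t\,(B|C)$, $x_{11}=S^+_t\,(A|A)$, $x_{12}=S^+_t\,(C|C)$. * Over $\mathcal B(2,2)$: $y_1=S^-_t\,(AC|AC)$, $y_2=W_t\,(BC|AC)$, $y_3=S^-_b\,(AC|AC)$, $y_4=E_b\,(AB|AC)$, $y_5=W_b\,(BC|AC)$,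 $y_6=S^+_b\,(AC|AC)$, $y_7=E_t\,(AB|AC)$, $y_8=S^+_t\,(AC|AC)$. * Over $\mathcal B(2,3)$: zero. Gradings by type, as (homological; Alexander): $S^-_t:(1;0)$, $W_t:(0;\beta_1)$, $S^-_b:(0;\tau_2+\beta_2)$, $E_b:(0;\tau_2)$, $W_b:(-1;\tau_2+\beta_1+\beta_2)$, $S^+_b:(-1;\tau_2+\beta_2)$, $E_t:(-1;\tau_1+\tau_2+\beta_1)$, $S^+_t:(-2;\tau_1+\tau_2+\beta_1+\beta_2)$. Operations (evaluated on basis inputs; all values not listed are zero; the idempotents of algebra labels are determined by the adjacent basis elements). In all summands $\delta^1_2(x\otimes\mathbf I')=\mathbf I\otimes x$ for $\mathbf I,\mathbf I'$ the left and right idempotents of $x$; $\delta^1_2$ vanishes on all non-idempotent basis inputs, and $\delta^1_i=0$ for $i>2$ if some input is an idempotent. Over $\mathcal B(2,0)$: $\delta^1_1(z_3)=\mathbf I_\varnothing\otimes z_2$. Over $\mathcal B(2,1)$: $\delta^1_1$: $x_3\mapsto L_1\otimes x_1$; $x_5\mapsto U_2\otimes x_2$; $x_6\mapsto R_2\otimes x_2$; $x_7\mapsto U_2\otimes x_3+L_1\otimes x_4$; $x_8\mapsto \mathbf I_A\otimes x_4$; $x_9\mapsto\mathbf I_C\otimes x_5+L_2\otimes x_6$; $x_{10}\mapsto U_1\otimes x_6$; $x_{11}\mapsto R_1\otimes x_7+U_1\otimes x_8$; $x_{12}\mapsto L_2\otimes x_{10}$. $\delta^1_3$ with inputs $(R_1,R_2)$: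 $x_1\mapsto R_1\otimes x_6$; $x_3\mapsto\mathbf I_B\otimes x_{10}$; $x_7\mapsto R_2\otimes x_{12}$. With inputs $(L_2,L_1)$: $x_2\mapsto L_2\otimes x_3$; $x_5\mapsto L_2\otimes x_7$; $x_6\mapsto\mathbf I_B\otimes x_7+L_1\otimes x_8$; $x_{10}\mapsto L_1\otimes x_{11}$. $\delta^1_4$ with inputs $(R_1,U_2,L_1)$: $x_1\mapsto R_1\otimes x_7+U_1\otimes x_8$; $x_3\mapsto L_1\otimes x_{11}$. With inputs $(L_2,U_1,R_2)$: $x_2\mapsto L_2\otimes x_{10}$; $x_5\mapsto U_2\otimes x_{12}$; $x_6\mapsto R_2\otimes x_{12}$. Over $\mathcal B(2,2)$, with $P=\{(U_1,U_2),(L_2U_1,R_2),(R_1,L_1U_2)\}$: $\delta^1_1$: $y_2\mapsto L_1\otimes y_1$; $y_3\mapsto U_2\otimes y_1$; $y_4\mapsto R_2\otimes y_1$; $y_5\mapsto U_2\otimes y_2+L_1\otimes y_3$; $y_6\mapsto\mathbf I_{AC}\otimes y_3+L_2\otimes y_4$; $y_7\mapsto R_2R_1\otimes y_2+U_1\otimes y_4$; $y_8\mapsto R_1\otimes y_5+U_1\otimes y_6+L_2\otimes y_7$. $\delta^1_3$ with inputs any pair in $P$: $y_1\mapsto R_1U_2\otimes y_2+L_2U_1\otimes y_4$; $y_2\mapsto L_1L_2\otimes y_7$; $y_3\mapsto R_1U_2\otimes y_5+U_1U_2\otimes y_6$; $y_4\mapsto R_2R_1\otimes y_5+R_2U_1\otimes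 y_6$; $y_5\mapsto L_1U_2\otimes y_8$; $y_7\mapsto R_2U_1\otimes y_8$. $\delta^1_4$ with inputs $(R_1,U_2,L_1)$: $y_1\mapsto R_1\otimes y_5+U_1\otimes y_6$; $y_2\mapsto L_1\otimes y_8$. With inputs $(L_2,U_1,R_2)$: $y_1\mapsto L_2\otimes y_7$; $y_3\mapsto U_2\otimes y_8$; $y_4\mapsto R_2\otimes y_8$. $\delta^1_5$ with inputs $(p_1,p_2,q_1,q_2)$ for any $(p_1,p_2),(q_1,q_2)\in P$ (nine sequences): $y_1\mapsto U_1U_2\otimes y_8$. **The simplified bimodule $\widetilde{\mathcal X}^{DA}$.** Its basis consists of $z_1,z_4$; $x_1,x_2,x_3,x_6,x_7,x_{10},x_{11},x_{12}$; $y_1,y_2,y_4,y_5,y_7,y_8$, with the same idempotents and gradings that the basis elements of these names have in $\mathcal X^{DA}$, namely: $z_1=S^-_t\,(\varnothing|\varnothing)$, $z_4=S^+_t\,(\varnothing|\varnothing)$; $x_1=S^-_t\,(A|A)$, $x_2=S^-_t\,(C|C)$, $x_3=W_t\,(B|A)$, $x_6=E_b\,(B|C)$, $x_7=W_b\,(B|A)$, $x_{10}=E_t\,(B|C)$, $x_{11}=S^+_t\,(A|A)$, $x_{12}=S^+_t\,(C|C)$; $y_1=S^-_t\,(AC|AC)$, $y_2=W_t\,(BC|AC)$, $y_4=E_b\,(AB|AC)$, $y_5=W_b\,(BC|AC)$, $y_7=E_t\,(AB|AC)$, $y_8=S^+_t\,(AC|AC)$; with gradings by type, as (homological; Alexander),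 $S^-_t:(1;0)$, $W_t:(0;\beta_1)$, $E_b:(0;\tau_2)$, $W_b:(-1;\tau_2+\beta_1+\beta_2)$, $E_t:(-1;\tau_1+\tau_2+\beta_1)$, $S^+_t:(-2;\tau_1+\tau_2+\beta_1+\beta_2)$. The operation $\delta^1_2$ and the vanishing on idempotent inputs are as for $\mathcal X^{DA}$; all values not listed are zero. Over $\mathcal B(2,0)$: no nonzero operations except the identity $\delta^1_2$. Over $\mathcal B(2,1)$: $\delta^1_1$: $x_3\mapsto L_1\otimes x_1$; $x_6\mapsto R_2\otimes x_2$; $x_7\mapsto U_2\otimes x_3$; $x_{10}\mapsto U_1\otimes x_6$; $x_{11}\mapsto R_1\otimes x_7$; $x_{12}\mapsto L_2\otimes x_{10}$. $\delta^1_3$ with inputs $(R_1,R_2)$: $x_1\mapsto R_1\otimes x_6$; $x_3\mapsto\mathbf I_B\otimes x_{10}$; $x_7\mapsto R_2\otimes x_{12}$. With inputs $(L_2,L_1)$: $x_2\mapsto L_2\otimes x_3$; $x_6\mapsto\mathbf I_B\otimes x_7$; $x_{10}\mapsto L_1\otimes x_{11}$. $\delta^1_4$ with inputs $(R_1,U_2,L_1)$: $x_1\mapsto R_1\otimes x_7$; $x_3\mapsto L_1\otimes x_{11}$. With inputs $(L_2,U_1,R_2)$: $x_2\mapsto L_2\otimes x_{10}$; $x_6\mapsto R_2\otimes x_{12}$. Over $\mathcal B(2,2)$: $\delta^1_1$: $y_2\mapsto L_1\otimes y_1$; $y_4\mapsto R_2\otimes y_1$; $y_5\mapsto U_2\otimes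 y_2+L_1L_2\otimes y_4$; $y_7\mapsto R_2R_1\otimes y_2+U_1\otimes y_4$; $y_8\mapsto R_1\otimes y_5+L_2\otimes y_7$. $\delta^1_3$ with inputs any pair in $P$: $y_1\mapsto R_1U_2\otimes y_2+L_2U_1\otimes y_4$; $y_2\mapsto L_1L_2\otimes y_7$; $y_4\mapsto R_2R_1\otimes y_5$; $y_5\mapsto L_1U_2\otimes y_8$; $y_7\mapsto R_2U_1\otimes y_8$. $\delta^1_4$ with inputs $(R_1,U_2,L_1)$: $y_1\mapsto R_1\otimes y_5$; $y_2\mapsto L_1\otimes y_8$. With inputs $(L_2,U_1,R_2)$: $y_1\mapsto L_2\otimes y_7$; $y_4\mapsto R_2\otimes y_8$. $\delta^1_5$ with inputs $(p_1,p_2,q_1,q_2)$ for any $(p_1,p_2),(q_1,q_2)\in P$: $y_1\mapsto U_1U_2\otimes y_8$. *)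

theory Defs
  imports
    Complex_Main
    "HOL-Library.Poly_Mapping"
    "HOL-Library.Product_Plus"
    "HOL-Library.Z2"
begin

section \<open>The quiver and its path algebra over the field with two elements\<close>

type_synonym vertex = "nat set"

datatype label = R nat | L nat | U nat

definition vertices :: "vertex set" where
  "vertices = Pow {0, 1, 2}"

fun has_arrow :: "vertex \<Rightarrow> label \<Rightarrow> bool" where
  "has_arrow x (R i) \<longleftrightarrow> x \<in> vertices \<and> i \<in> {1, 2} \<and> x \<inter> {i - 1, i} = {i - 1}"
| "has_arrow x (L i) \<longleftrightarrow> x \<in> vertices \<and> i \<in> {1, 2} \<and> x \<inter> {i - 1, i} = {i}"
| "has_arrow x (U i) \<longleftrightarrow> x \<in> vertices \<and> i \<in> {1, 2}"

fun target :: "vertex \<Rightarrow> label \<Rightarrow> vertex" where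
  "target x (R i) = (x - {i - 1}) \<union> {i}"
| "target x (L i) = (x - {i}) \<union> {i - 1}"
| "target x (U i) = x"

text \<open>An arrow is determined by its source and its label, so a path is determined by its
  initial vertex and the list of its labels, read from left to right.\<close>

fun is_path :: "vertex \<Rightarrow> label list \<Rightarrow> bool" where
  "is_path x [] \<longleftrightarrow> x \<in> vertices"
| "is_path x (l # ls) \<longleftrightarrow> has_arrow x l \<and> is_path (target x l) ls"

definition endpoint :: "vertex \<Rightarrow> label list \<Rightarrow> vertex" where
  "endpoint x ls = foldl target x ls"

typedef qpath = "{(x, ls). is_path x ls}"
proof
  show "({}, []) \<in> {(x, ls). is_path x ls}" by (simp add: vertices_def)
qed

definition qstart :: "qpath \<Rightarrow> vertex" where
  "qstart p = fst (Rep_qpath p)"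

definition qlabels :: "qpath \<Rightarrow> label list" where
  "qlabels p = snd (Rep_qpath p)"

definition qend :: "qpath \<Rightarrow> vertex" where
  "qend p = endpoint (qstart p) (qlabels p)"

definition mk_path :: "vertex \<Rightarrow> label list \<Rightarrow> qpath" where
  "mk_path x ls = Abs_qpath (x, ls)"

definition concat_path :: "qpath \<Rightarrow> qpath \<Rightarrow> qpath" where
  "concat_path p q = mk_path (qstart p) (qlabels p @ qlabels q)"

type_synonym path_algebra = "qpath \<Rightarrow>\<^sub>0 bit"

definition pa_mult :: "path_algebra \<Rightarrow> path_algebra \<Rightarrow> path_algebra" where
  "pa_mult a b = (\<Sum>p\<in>Poly_Mapping.keys a. \<Sum>q\<in>Poly_Mapping.keys b.
     if qend p = qstart q
     then Poly_Mapping.single (concat_path p q)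
            (Poly_Mapping.lookup a p * Poly_Mapping.lookup b q)
     else 0)"

definition pa_one :: path_algebra where
  "pa_one = (\<Sum>x\<in>vertices. Poly_Mapping.single (mk_path x []) 1)"

definition pa_word :: "vertex \<Rightarrow> label list \<Rightarrow> path_algebra" where
  "pa_word x ls = (if is_path x ls then Poly_Mapping.single (mk_path x ls) 1 else 0)"

section \<open>The relations and the algebra \<open>B(2)\<close>\<close>

definition relations :: "path_algebra set" where
  "relations =
     {pa_word x [U i, l] - pa_word x [l, U i] | x i l. i \<in> {1, 2} \<and> has_arrow x l}
   \<union> {pa_word x [R i, L i] - pa_word x [U i] | x i. has_arrow x (R i)}
   \<union> {pa_word x [L i, R i] - pa_word x [U i] | x i. has_arrow x (L i)}
   \<union> {pa_word x [R 1, R 2] | x. is_path x [R 1, R 2]}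
   \<union> {pa_word x [L 2, L 1] | x. is_path x [L 2, L 1]}
   \<union> {pa_word x [U i] | x i. x \<in> vertices \<and> i \<in> {1, 2} \<and> x \<inter> {i - 1, i} = {}}"

inductive_set relation_ideal :: "path_algebra set" where
  rel: "r \<in> relations \<Longrightarrow> r \<in> relation_ideal"
| zero: "0 \<in> relation_ideal"
| add: "a \<in> relation_ideal \<Longrightarrow> b \<in> relation_ideal \<Longrightarrow> a + b \<in> relation_ideal"
| mult_left: "a \<in> relation_ideal \<Longrightarrow> pa_mult b a \<in> relation_ideal"
| mult_right: "a \<in> relation_ideal \<Longrightarrow> pa_mult a b \<in> relation_ideal"

definition ideal_rel :: "path_algebra \<Rightarrow> path_algebra \<Rightarrow> bool" where
  "ideal_rel a b \<longleftrightarrow> a - b \<in> relation_ideal"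

subsection \<open>The path algebra is a ring\<close>

lemma has_arrow_vertices: "has_arrow x l \<Longrightarrow> x \<in> vertices"
  by (cases l) auto

lemma has_arrow_target: "has_arrow x l \<Longrightarrow> target x l \<in> vertices"
  by (cases l) (auto simp: vertices_def)

lemma is_path_vertices: "is_path x ls \<Longrightarrow> x \<in> vertices"
  by (cases ls) (auto dest: has_arrow_vertices)

lemma is_path_append:
  "is_path x (ls @ ms) \<longleftrightarrow> is_path x ls \<and> is_path (endpoint x ls) ms"
  by (induction ls arbitrary: x) (auto simp: endpoint_def dest: is_path_vertices)

lemma endpoint_append [simp]: "endpoint x (ls @ ms) = endpoint (endpoint x ls) ms"
  by (simp add: endpoint_def)

lemma endpoint_Nil [simp]: "endpoint x [] = x"
  by (simp add: endpoint_def)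

lemma is_path_endpoint: "is_path x ls \<Longrightarrow> endpoint x ls \<in> vertices"
  by (induction ls arbitrary: x) (auto simp: endpoint_def)

lemma is_path_qpath: "is_path (qstart p) (qlabels p)"
  using Rep_qpath[of p] by (auto simp: qstart_def qlabels_def)

lemma mk_path_collapse [simp]: "mk_path (qstart p) (qlabels p) = p"
  by (simp add: mk_path_def qstart_def qlabels_def Rep_qpath_inverse)

lemma qstart_mk [simp]: "is_path x ls \<Longrightarrow> qstart (mk_path x ls) = x"
  by (simp add: mk_path_def qstart_def Abs_qpath_inverse)

lemma qlabels_mk [simp]: "is_path x ls \<Longrightarrow> qlabels (mk_path x ls) = ls"
  by (simp add: mk_path_def qlabels_def Abs_qpath_inverse)

lemma qend_mk [simp]: "is_path x ls \<Longrightarrow> qend (mk_path x ls) = endpoint x ls"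
  by (simp add: qend_def)

lemma qpath_eqI: "qstart p = qstart q \<Longrightarrow> qlabels p = qlabels q \<Longrightarrow> p = q"
  by (metis mk_path_collapse)

lemma is_path_concat:
  "qend p = qstart q \<Longrightarrow> is_path (qstart p) (qlabels p @ qlabels q)"
  by (simp add: is_path_append is_path_qpath flip: qend_def)

lemma concat_path_sel [simp]:
  assumes "qend p = qstart q"
  shows "qstart (concat_path p q) = qstart p" "qend (concat_path p q) = qend q"
    "qlabels (concat_path p q) = qlabels p @ qlabels q"
  using is_path_concat[OF assms] assms by (auto simp: concat_path_def qend_def)

lemma poly_mapping_add_induct [case_names zero single add]:
  fixes a :: "'k \<Rightarrow>\<^sub>0 'c::comm_monoid_add"
  assumes "P 0" "\<And>k c. P (Poly_Mapping.single k c)" "\<And>a b. P a \<Longrightarrow> P b \<Longrightarrow> P (a + b)"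
  shows "P a"
proof (induction a rule: update_induct)
  case const
  then show ?case using assms(1) by simp
next
  case (update f k c)
  have "Poly_Mapping.update k c f = f + Poly_Mapping.single k c"
    using update by (intro poly_mapping_eqI)
      (auto simp: lookup_update lookup_add lookup_single in_keys_iff when_def)
  then show ?case using assms(2,3) update by simp
qed

definition path_prod :: "qpath \<Rightarrow> bit \<Rightarrow> qpath \<Rightarrow> bit \<Rightarrow> path_algebra" where
  "path_prod p c q d =
     (if qend p = qstart q then Poly_Mapping.single (concat_path p q) (c * d) else 0)"

lemma pa_mult_alt: "pa_mult a b = (\<Sum>p\<in>Poly_Mapping.keys a. \<Sum>q\<in>Poly_Mapping.keys b.
    path_prod p (Poly_Mapping.lookup a p) q (Poly_Mapping.lookup b q))"
  by (simp add: pa_mult_def path_prod_def)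

lemma path_prod_zero [simp]: "path_prod p 0 q d = 0" "path_prod p c q 0 = 0"
  by (simp_all add: path_prod_def)

lemma path_prod_add:
  "path_prod p (c + c') q d = path_prod p c q d + path_prod p c' q d"
  "path_prod p c q (d + d') = path_prod p c q d + path_prod p c q d'"
  by (simp_all only: path_prod_def distrib_left distrib_right single_add add_0 split: if_split)
     simp_all

lemma pa_mult_add_left: "pa_mult (a + b) c = pa_mult a c + pa_mult b c"
  unfolding pa_mult_alt
  by (rule setsum_keys_plus_distrib) (simp_all only: path_prod_zero path_prod_add sum.distrib sum.neutral_const)

lemma pa_mult_add_right: "pa_mult a (b + c) = pa_mult a b + pa_mult a c"
  unfolding pa_mult_alt sum.distrib[symmetric]
  by (intro sum.cong refl setsum_keys_plus_distrib) (simp_all only: path_prod_zero path_prod_add)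

lemma pa_mult_zero [simp]: "pa_mult 0 a = 0" "pa_mult a 0 = 0"
  by (simp_all add: pa_mult_def)

lemma pa_mult_single:
  "pa_mult (Poly_Mapping.single p c) (Poly_Mapping.single q d) = path_prod p c q d"
  by (cases "c = 0"; cases "d = 0") (auto simp: pa_mult_alt path_prod_def)

lemma pa_mult_assoc: "pa_mult (pa_mult a b) c = pa_mult a (pa_mult b c)"
proof (induction a rule: poly_mapping_add_induct)
  case (single p u)
  show ?case
  proof (induction b rule: poly_mapping_add_induct)
    case (single q v)
    show ?case
    proof (induction c rule: poly_mapping_add_induct)
      case (single r w)
      have "concat_path (concat_path p q) r = concat_path p (concat_path q r)"
        if "qend p = qstart q" "qend q = qstart r"
        using that by (intro qpath_eqI) simp_all
      then show ?case
        by (auto simp: pa_mult_single path_prod_def mult.assoc)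
    qed (simp_all add: pa_mult_add_right)
  qed (simp_all add: pa_mult_add_right pa_mult_add_left)
qed (simp_all add: pa_mult_add_left)

lemma finite_vertices [simp]: "finite vertices"
  by (simp add: vertices_def)

lemma pa_mult_sum_left: "pa_mult (\<Sum>x\<in>S. f x) a = (\<Sum>x\<in>S. pa_mult (f x) a)"
  by (induction S rule: infinite_finite_induct) (simp_all add: pa_mult_add_left)

lemma pa_mult_sum_right: "pa_mult a (\<Sum>x\<in>S. f x) = (\<Sum>x\<in>S. pa_mult a (f x))"
  by (induction S rule: infinite_finite_induct) (simp_all add: pa_mult_add_right)

lemma qstart_vertices: "qstart p \<in> vertices"
  using is_path_qpath is_path_vertices by blast

lemma qend_vertices: "qend p \<in> vertices"
  using is_path_qpath is_path_endpoint qend_def by metis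

lemma pa_mult_one_left: "pa_mult pa_one a = a"
proof (induction a rule: poly_mapping_add_induct)
  case (single p c)
  have *: "pa_mult (Poly_Mapping.single (mk_path x []) 1) (Poly_Mapping.single p c)
      = (if x = qstart p then Poly_Mapping.single p c else 0)" if "x \<in> vertices" for x
    using that by (auto simp: pa_mult_single path_prod_def concat_path_def)
  show ?case
    using qstart_vertices[of p]
    by (simp add: pa_one_def pa_mult_sum_left * sum.delta cong: sum.cong)
qed (simp_all add: pa_mult_add_right)

lemma pa_mult_one_right: "pa_mult a pa_one = a"
proof (induction a rule: poly_mapping_add_induct)
  case (single p c)
  have *: "pa_mult (Poly_Mapping.single p c) (Poly_Mapping.single (mk_path x []) 1)
      = (if x = qend p then Poly_Mapping.single p c else 0)" if "x \<in> vertices" for x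
    using that by (auto simp: pa_mult_single path_prod_def concat_path_def)
  show ?case
    using qend_vertices[of p]
    by (simp add: pa_one_def pa_mult_sum_right * sum.delta cong: sum.cong)
qed (simp_all add: pa_mult_add_left)

subsection \<open>The quotient\<close>

lemma pa_char_two: "(a :: path_algebra) + a = 0"
  by (intro poly_mapping_eqI) (simp add: lookup_add)

lemma pa_uminus: "- a = (a :: path_algebra)"
  using pa_char_two[of a] by (simp add: minus_unique)

lemma pa_diff: "a - b = (a + b :: path_algebra)"
  using pa_uminus[of b] by (metis diff_conv_add_uminus)

lemma relation_ideal_diff:
  "a \<in> relation_ideal \<Longrightarrow> b \<in> relation_ideal \<Longrightarrow> a - b \<in> relation_ideal"
  by (simp add: pa_diff relation_ideal.add)

lemma lookup_trivial_single:
  "x \<in> vertices \<Longrightarrow> Poly_Mapping.lookup (Poly_Mapping.single p c) (mk_path x []) =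
    (if qstart p = x \<and> qlabels p = [] then c else 0)"
  by (auto simp: lookup_single when_def intro!: qpath_eqI)

lemma lookup_trivial_pa_mult:
  assumes x: "x \<in> vertices"
  shows "Poly_Mapping.lookup (pa_mult a b) (mk_path x []) =
    Poly_Mapping.lookup a (mk_path x []) * Poly_Mapping.lookup b (mk_path x [])"
proof (induction a rule: poly_mapping_add_induct)
  case (single p c)
  show ?case
  proof (induction b rule: poly_mapping_add_induct)
    case (single q d)
    show ?case
      using x by (auto simp: pa_mult_single path_prod_def lookup_trivial_single qend_def)
  qed (simp_all add: pa_mult_add_right lookup_add distrib_left)
qed (simp_all add: pa_mult_add_left lookup_add distrib_right)

lemma lookup_trivial_relation_ideal:
  assumes "a \<in> relation_ideal" "x \<in> vertices"
  shows "Poly_Mapping.lookup a (mk_path x []) = 0"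
  using assms
proof (induction a rule: relation_ideal.induct)
  case (rel r)
  have "Poly_Mapping.lookup (pa_word y (l # ls)) (mk_path x []) = 0" for y l ls
    using rel(2) by (auto simp: pa_word_def lookup_trivial_single simp del: is_path.simps(2))
  then show ?case
    using rel by (auto simp: relations_def pa_diff lookup_add simp del: is_path.simps)
qed (simp_all add: lookup_add lookup_trivial_pa_mult)

quotient_type B2 = path_algebra / ideal_rel
proof (rule equivpI)
  show "reflp ideal_rel"
    by (simp add: reflp_def ideal_rel_def relation_ideal.zero)
  show "symp ideal_rel"
    by (simp add: symp_def ideal_rel_def pa_diff add.commute)
  show "transp ideal_rel"
    unfolding transp_def ideal_rel_def
    by (metis diff_add_cancel add_diff_eq relation_ideal.add)
qed

instantiation B2 :: ring_1
begin

lift_definition zero_B2 :: B2 is 0 .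

lift_definition one_B2 :: B2 is pa_one .

lift_definition plus_B2 :: "B2 \<Rightarrow> B2 \<Rightarrow> B2" is "(+)"
  unfolding ideal_rel_def by (metis add_diff_add relation_ideal.add)

lift_definition uminus_B2 :: "B2 \<Rightarrow> B2" is uminus
  by (simp only: pa_uminus)

lift_definition minus_B2 :: "B2 \<Rightarrow> B2 \<Rightarrow> B2" is "(-)"
  unfolding ideal_rel_def pa_diff
  by (metis (no_types, lifting) add.assoc add.commute relation_ideal.add)

lift_definition times_B2 :: "B2 \<Rightarrow> B2 \<Rightarrow> B2" is pa_mult
proof -
  fix a a' b b' assume "ideal_rel a a'" "ideal_rel b b'"
  then have "pa_mult (a - a') b + pa_mult a' (b - b') \<in> relation_ideal"
    unfolding ideal_rel_def
    by (intro relation_ideal.add relation_ideal.mult_left relation_ideal.mult_right)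
  moreover have "pa_mult (a - a') b + pa_mult a' (b - b') = pa_mult a b - pa_mult a' b'"
    by (simp add: pa_diff pa_mult_add_left pa_mult_add_right)
       (metis (no_types, lifting) add.assoc add.right_neutral pa_char_two add.commute)
  ultimately show "ideal_rel (pa_mult a b) (pa_mult a' b')"
    unfolding ideal_rel_def by simp
qed

instance
proof
  have refl: "ideal_rel a a" for a
    by (simp add: ideal_rel_def relation_ideal.zero)
  fix a b c :: B2
  show "a * b * c = a * (b * c)" by transfer (simp add: pa_mult_assoc refl)
  show "1 * a = a" by transfer (simp add: pa_mult_one_left refl)
  show "a * 1 = a" by transfer (simp add: pa_mult_one_right refl)
  show "a + b + c = a + (b + c)" by transfer (simp add: add.assoc refl)
  show "a + b = b + a" by transfer (simp add: add.commute refl)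
  show "0 + a = a" by transfer (simp add: refl)
  show "- a + a = 0" by transfer (simp add: refl)
  show "a - b = a + - b" by transfer (simp add: refl)
  show "(a + b) * c = a * c + b * c" by transfer (simp add: pa_mult_add_left refl)
  show "a * (b + c) = a * b + a * c" by transfer (simp add: pa_mult_add_right refl)
  show "(0::B2) \<noteq> 1"
  proof transfer
    have v: "{} \<in> vertices" by (simp add: vertices_def)
    have "Poly_Mapping.lookup pa_one (mk_path {} []) =
        (\<Sum>x\<in>vertices. if x = {} then 1 else 0)"
      unfolding pa_one_def lookup_sum
      by (intro sum.cong) (auto simp: lookup_trivial_single v)
    also have "\<dots> = 1" using v by simp
    finally show "\<not> ideal_rel 0 pa_one"
      using lookup_trivial_relation_ideal[OF _ v, of pa_one]
      by (auto simp: ideal_rel_def pa_diff)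
  qed
qed

end

section \<open>Structure of \<open>B(2)\<close>\<close>

text \<open>The class of the path that starts at a given vertex and follows the given labels. The value
  \<open>0\<close> on label lists that are not paths is a convention.\<close>

definition elt :: "vertex \<Rightarrow> label list \<Rightarrow> B2" where
  "elt x ls = abs_B2 (pa_word x ls)"

definition Idem :: "vertex \<Rightarrow> B2" where
  "Idem x = elt x []"

lift_definition augmentation :: "B2 \<Rightarrow> B2" is
  "\<lambda>a. \<Sum>x\<in>vertices. Poly_Mapping.single (mk_path x []) (Poly_Mapping.lookup a (mk_path x []))"
proof -
  fix a b assume "ideal_rel a b"
  then have "Poly_Mapping.lookup a (mk_path x []) = Poly_Mapping.lookup b (mk_path x [])"
    if "x \<in> vertices" for x
    using that lookup_trivial_relation_ideal[of "a - b" x]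
    by (simp add: ideal_rel_def lookup_minus del: minus_bit_def)
  then show "ideal_rel
      (\<Sum>x\<in>vertices. Poly_Mapping.single (mk_path x []) (Poly_Mapping.lookup a (mk_path x [])))
      (\<Sum>x\<in>vertices. Poly_Mapping.single (mk_path x []) (Poly_Mapping.lookup b (mk_path x [])))"
    by (simp add: ideal_rel_def relation_ideal.zero cong: sum.cong)
qed

definition B2_plus :: "B2 set" where
  "B2_plus = {a. augmentation a = 0}"

text \<open>Alexander degrees, with coordinates in the order
  \<open>\<tau>\<^sub>1, \<beta>\<^sub>1, \<tau>\<^sub>2, \<beta>\<^sub>2\<close>.\<close>

type_synonym alexander = "int \<times> int \<times> int \<times> int"

definition tau1 :: alexander where "tau1 = (1, 0, 0, 0)"
definition beta1 :: alexander where "beta1 = (0, 1, 0, 0)"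
definition tau2 :: alexander where "tau2 = (0, 0, 1, 0)"
definition beta2 :: alexander where "beta2 = (0, 0, 0, 1)"

fun label_adeg :: "label \<Rightarrow> alexander" where
  "label_adeg (R i) = (if i = 1 then tau1 else tau2)"
| "label_adeg (L i) = (if i = 1 then beta1 else beta2)"
| "label_adeg (U i) = (if i = 1 then tau1 + beta1 else tau2 + beta2)"

definition homogeneous :: "alexander \<Rightarrow> B2 \<Rightarrow> bool" where
  "homogeneous v a \<longleftrightarrow> (\<exists>p. abs_B2 p = a \<and>
     (\<forall>q\<in>Poly_Mapping.keys p. sum_list (map label_adeg (qlabels q)) = v))"

definition scale :: "bit \<Rightarrow> B2 \<Rightarrow> B2" where
  "scale c a = (if c = 1 then a else 0)"

lemma B2_char_two: "(a :: B2) + a = 0"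
  by transfer (simp add: ideal_rel_def pa_char_two relation_ideal.zero)

interpretation B2: vector_space scale
proof
  fix a b :: bit and x y :: B2
  show "scale (a + b) x = scale a x + scale b x"
    by (cases a; cases b) (simp_all add: scale_def B2_char_two)
qed (auto simp: scale_def)

text \<open>The basis of \<open>B(2)\<close> in which operations are specified; the four parts are
  the bases of \<open>B(2, k)\<close> for \<open>k = 0, 1, 2, 3\<close>.\<close>

abbreviation vA :: vertex where "vA \<equiv> {0}"
abbreviation vB :: vertex where "vB \<equiv> {1}"
abbreviation vC :: vertex where "vC \<equiv> {2}"
abbreviation vAB :: vertex where "vAB \<equiv> {0, 1}"
abbreviation vAC :: vertex where "vAC \<equiv> {0, 2}"
abbreviation vBC :: vertex where "vBC \<equiv> {1, 2}"
abbreviation vABC :: vertex where "vABC \<equiv> {0, 1, 2}"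

abbreviation Upow :: "nat \<Rightarrow> nat \<Rightarrow> label list" where
  "Upow k i \<equiv> replicate i (U k)"

definition B2_basis :: "B2 set" where
  "B2_basis =
     {Idem {}}
   \<union> ({elt vA (Upow 1 i) | i. True} \<union> {elt vA (R 1 # Upow 1 i) | i. True}
      \<union> {elt vB (L 1 # Upow 1 i) | i. True}
      \<union> {Idem vB} \<union> {elt vB (Upow 1 (i + 1)) | i. True} \<union> {elt vB (Upow 2 (i + 1)) | i. True}
      \<union> {elt vB (R 2 # Upow 2 i) | i. True}
      \<union> {elt vC (L 2 # Upow 2 i) | i. True} \<union> {elt vC (Upow 2 i) | i. True})
   \<union> {elt x (p @ Upow 1 i @ Upow 2 j) | x p i j. (x, p) \<in>
        {(vAB, []), (vAC, []), (vBC, []), (vAB, [R 2]), (vAB, [R 2, R 1]), (vAC, [L 2]),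
         (vAC, [R 1]), (vBC, [L 1, L 2]), (vBC, [L 1])}}
   \<union> {elt vABC (Upow 1 i @ Upow 2 j) | i j. True}"

definition coefficient :: "B2 \<Rightarrow> B2 \<Rightarrow> bit" where
  "coefficient b a = B2.representation B2_basis a b"

section \<open>DA bimodules over \<open>(B(2), B(2))\<close>\<close>

text \<open>Because the idempotent ring is a finite product of copies of the ground field, every graded
  bimodule \<open>X\<close> over it has a homogeneous basis each of whose elements has a left and a
  right idempotent. A bimodule is presented here by such a basis \<open>gens X\<close>.

  An element of the tensor product of \<open>B(2)\<close> and \<open>X\<close> over the idempotent ring is then a unique
  finite sum of terms \<open>b\<^sub>y \<otimes> y\<close> over basis elements \<open>y\<close>, with
  \<open>b\<^sub>y\<close> in \<open>B(2) I\<close> for \<open>I\<close> the left idempotent of \<open>y\<close>. It is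
  represented by the finitely supported function sending \<open>y\<close> to \<open>b\<^sub>y\<close>.

  An operation with \<open>n\<close> algebra inputs is a linear map out of the tensor product over the
  idempotent ring of \<open>X\<close> and \<open>n\<close> copies of \<open>B(2)\<close>, and so it is given by its values on a basis
  element of \<open>X\<close> and a list of \<open>n\<close> algebra elements, subject to the condition \<open>da_map\<close> below.
  In particular \<open>delta X x as\<close> is the value of the operation whose index is
  \<open>length as + 1\<close>.\<close>

type_synonym ('g, 'h) operation = "'g \<Rightarrow> B2 list \<Rightarrow> ('h \<Rightarrow>\<^sub>0 B2)"

record 'g bimodule =
  gens :: "'g set"
  lid :: "'g \<Rightarrow> vertex"
  rid :: "'g \<Rightarrow> vertex"
  hdeg :: "'g \<Rightarrow> int"
  adeg :: "'g \<Rightarrow> alexander"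
  delta :: "('g, 'g) operation"

definition in_tensor :: "'h bimodule \<Rightarrow> ('h \<Rightarrow>\<^sub>0 B2) \<Rightarrow> bool" where
  "in_tensor Y t \<longleftrightarrow> Poly_Mapping.keys t \<subseteq> gens Y
     \<and> (\<forall>y\<in>gens Y. Poly_Mapping.lookup t y * Idem (lid Y y) = Poly_Mapping.lookup t y)"

definition left_mult :: "B2 \<Rightarrow> ('h \<Rightarrow>\<^sub>0 B2) \<Rightarrow> ('h \<Rightarrow>\<^sub>0 B2)" where
  "left_mult b t = Poly_Mapping.map ((*) b) t"

definition right_idem :: "'h bimodule \<Rightarrow> ('h \<Rightarrow>\<^sub>0 B2) \<Rightarrow> vertex \<Rightarrow> ('h \<Rightarrow>\<^sub>0 B2)" where
  "right_idem Y t v = (\<Sum>y\<in>Poly_Mapping.keys t.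
     if rid Y y = v then Poly_Mapping.single y (Poly_Mapping.lookup t y) else 0)"

text \<open>\<open>da_map D k X Y F\<close>: the family \<open>F\<close> consists of well-defined maps on the tensor products
  over the idempotent ring of \<open>X\<close> with copies of \<open>D\<close>, which are linear over this ring from both
  sides, preserve the Alexander degree and, with \<open>i\<close> the index of the operation, change the
  homological degree by \<open>k + 1 - i\<close>. Over the field with two elements linearity is additivity.\<close>

definition da_map ::
  "B2 set \<Rightarrow> int \<Rightarrow> 'g bimodule \<Rightarrow> 'h bimodule \<Rightarrow> ('g, 'h) operation \<Rightarrow> bool" where
  "da_map D k X Y F \<longleftrightarrow> (\<forall>x\<in>gens X.
     (\<forall>as\<in>lists D. in_tensor Y (F x as))
   \<and> (\<forall>as\<in>lists D. \<forall>cs\<in>lists D. \<forall>a\<in>D. \<forall>b\<in>D.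
        F x (as @ [a + b] @ cs) = F x (as @ [a] @ cs) + F x (as @ [b] @ cs))
   \<and> (\<forall>as\<in>lists D. \<forall>cs\<in>lists D. \<forall>a\<in>D. \<forall>b\<in>D. \<forall>v\<in>vertices.
        F x (as @ [a * Idem v, b] @ cs) = F x (as @ [a, Idem v * b] @ cs))
   \<and> (\<forall>a\<in>D. \<forall>cs\<in>lists D. \<forall>v\<in>vertices.
        F x ((Idem v * a) # cs) = (if rid X x = v then F x (a # cs) else 0))
   \<and> (\<forall>as\<in>lists D. \<forall>v\<in>vertices.
        left_mult (Idem v) (F x as) = (if lid X x = v then F x as else 0))
   \<and> (\<forall>v\<in>vertices. right_idem Y (F x []) v = (if rid X x = v then F x [] else 0))
   \<and> (\<forall>as\<in>lists D. \<forall>a\<in>D. \<forall>v\<in>vertices.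
        F x (as @ [a * Idem v]) = right_idem Y (F x (as @ [a])) v)
   \<and> (\<forall>as\<in>lists D. \<forall>y\<in>Poly_Mapping.keys (F x as).
        hdeg Y y = hdeg X x + (k + 1 - (int (length as) + 1)))
   \<and> (\<forall>as\<in>lists D. \<forall>vs. list_all2 homogeneous vs as \<longrightarrow>
        (\<forall>y\<in>Poly_Mapping.keys (F x as).
           homogeneous (adeg X x + sum_list vs - adeg Y y) (Poly_Mapping.lookup (F x as) y))))"

text \<open>\<open>da_comp G F\<close> is the sum over all ways to feed an initial segment of the inputs to \<open>F\<close> and
  the rest to \<open>G\<close>, multiplying the two algebra outputs.\<close>

definition da_comp :: "('h, 'k) operation \<Rightarrow> ('g, 'h) operation \<Rightarrow> ('g, 'k) operation" where
  "da_comp G F x as = (\<Sum>j\<le>length as. \<Sum>y\<in>Poly_Mapping.keys (F x (take j as)).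
     left_mult (Poly_Mapping.lookup (F x (take j as)) y) (G y (drop j as)))"

definition multiply_inputs :: "nat \<Rightarrow> B2 list \<Rightarrow> B2 list" where
  "multiply_inputs j as = take j as @ [as ! j * as ! (j + 1)] @ drop (j + 2) as"

definition da_merge :: "('g, 'h) operation \<Rightarrow> ('g, 'h) operation" where
  "da_merge F x as = (\<Sum>j<length as - 1. F x (multiply_inputs j as))"

definition da_bimodule :: "'g bimodule \<Rightarrow> bool" where
  "da_bimodule X \<longleftrightarrow>
     (\<forall>x\<in>gens X. lid X x \<in> vertices \<and> rid X x \<in> vertices)
   \<and> da_map UNIV 1 X X (delta X)
   \<and> (\<forall>x\<in>gens X. \<forall>as. da_comp (delta X) (delta X) x as + da_merge (delta X) x as = 0)"

section \<open>Morphisms and homotopy equivalence\<close>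

definition da_morphism ::
  "int \<Rightarrow> 'g bimodule \<Rightarrow> 'h bimodule \<Rightarrow> ('g, 'h) operation \<Rightarrow> bool" where
  "da_morphism k X Y f \<longleftrightarrow> da_map B2_plus k X Y f"

definition da_differential ::
  "'g bimodule \<Rightarrow> 'h bimodule \<Rightarrow> ('g, 'h) operation \<Rightarrow> ('g, 'h) operation" where
  "da_differential X Y f x as =
     da_comp (delta Y) f x as + da_comp f (delta X) x as + da_merge f x as"

definition da_id :: "'g bimodule \<Rightarrow> ('g, 'g) operation" where
  "da_id X x as = (if as = [] then Poly_Mapping.single x (Idem (lid X x)) else 0)"

text \<open>Morphisms only take inputs from \<open>B2_plus\<close>, so they are compared on such inputs.\<close>

definition homotopy_equivalent :: "'g bimodule \<Rightarrow> 'h bimodule \<Rightarrow> bool" where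
  "homotopy_equivalent X Y \<longleftrightarrow> da_bimodule X \<and> da_bimodule Y \<and>
     (\<exists>f g h h'. da_morphism 0 X Y f \<and> da_morphism 0 Y X g
       \<and> da_morphism (-1) X X h \<and> da_morphism (-1) Y Y h'
       \<and> (\<forall>x\<in>gens X. \<forall>as\<in>lists B2_plus. da_differential X Y f x as = 0)
       \<and> (\<forall>y\<in>gens Y. \<forall>as\<in>lists B2_plus. da_differential Y X g y as = 0)
       \<and> (\<forall>x\<in>gens X. \<forall>as\<in>lists B2_plus.
            da_comp g f x as + da_id X x as = da_differential X X h x as)
       \<and> (\<forall>y\<in>gens Y. \<forall>as\<in>lists B2_plus.
            da_comp f g y as + da_id Y y as = da_differential Y Y h' y as))"

section \<open>The two bimodules\<close>

datatype gen =
    Z1 | Z2 | Z3 | Z4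
  | X1 | X2 | X3 | X4 | X5 | X6 | X7 | X8 | X9 | X10 | X11 | X12
  | Y1 | Y2 | Y3 | Y4 | Y5 | Y6 | Y7 | Y8

text \<open>The suffix of \<open>S\<close> records the sign (\<open>p\<close> for plus, \<open>m\<close> for minus) and then \<open>t\<close> or \<open>b\<close>.\<close>

datatype gen_type = Smt | Smb | Spb | Spt | Wt | Wb | Et | Eb

primrec gen_data :: "gen \<Rightarrow> gen_type \<times> vertex \<times> vertex" where
  "gen_data Z1 = (Smt, {}, {})"
| "gen_data Z2 = (Smb, {}, {})"
| "gen_data Z3 = (Spb, {}, {})"
| "gen_data Z4 = (Spt, {}, {})"
| "gen_data X1 = (Smt, vA, vA)"
| "gen_data X2 = (Smt, vC, vC)"
| "gen_data X3 = (Wt, vB, vA)"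
| "gen_data X4 = (Smb, vA, vA)"
| "gen_data X5 = (Smb, vC, vC)"
| "gen_data X6 = (Eb, vB, vC)"
| "gen_data X7 = (Wb, vB, vA)"
| "gen_data X8 = (Spb, vA, vA)"
| "gen_data X9 = (Spb, vC, vC)"
| "gen_data X10 = (Et, vB, vC)"
| "gen_data X11 = (Spt, vA, vA)"
| "gen_data X12 = (Spt, vC, vC)"
| "gen_data Y1 = (Smt, vAC, vAC)"
| "gen_data Y2 = (Wt, vBC, vAC)"
| "gen_data Y3 = (Smb, vAC, vAC)"
| "gen_data Y4 = (Eb, vAB, vAC)"
| "gen_data Y5 = (Wb, vBC, vAC)"
| "gen_data Y6 = (Spb, vAC, vAC)"
| "gen_data Y7 = (Et, vAB, vAC)"
| "gen_data Y8 = (Spt, vAC, vAC)"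

definition gen_type_of :: "gen \<Rightarrow> gen_type" where "gen_type_of x = fst (gen_data x)"
definition gen_lid :: "gen \<Rightarrow> vertex" where "gen_lid x = fst (snd (gen_data x))"
definition gen_rid :: "gen \<Rightarrow> vertex" where "gen_rid x = snd (snd (gen_data x))"

primrec type_hdeg :: "gen_type \<Rightarrow> int" where
  "type_hdeg Smt = 1"
| "type_hdeg Wt = 0"
| "type_hdeg Smb = 0"
| "type_hdeg Eb = 0"
| "type_hdeg Wb = -1"
| "type_hdeg Spb = -1"
| "type_hdeg Et = -1"
| "type_hdeg Spt = -2"

primrec type_adeg :: "gen_type \<Rightarrow> alexander" where
  "type_adeg Smt = 0"
| "type_adeg Wt = beta1"
| "type_adeg Smb = tau2 + beta2"
| "type_adeg Eb = tau2"
| "type_adeg Wb = tau2 + beta1 + beta2"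
| "type_adeg Spb = tau2 + beta2"
| "type_adeg Et = tau1 + tau2 + beta1"
| "type_adeg Spt = tau1 + tau2 + beta1 + beta2"

text \<open>A table entry \<open>(x, ws, out)\<close> says that the operation sends \<open>x\<close> with the basis inputs given by
  the label lists \<open>ws\<close> to the sum of the terms \<open>(w, y)\<close> in \<open>out\<close>, each standing for
  \<open>w \<otimes> y\<close>. The first input starts at the right idempotent of \<open>x\<close>, every further input starts
  where the preceding one ends, and the algebra outputs start at the left idempotent of \<open>x\<close>.\<close>

type_synonym table = "(gen \<times> label list list \<times> (label list \<times> gen) list) list"

fun basis_inputs :: "vertex \<Rightarrow> label list list \<Rightarrow> B2 list" where
  "basis_inputs v [] = []"
| "basis_inputs v (w # ws) = elt v w # basis_inputs (endpoint v w) ws"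

text \<open>The multilinear extension of a table, together with the identity operation on one
  idempotent input.\<close>

definition table_delta :: "table \<Rightarrow> (gen, gen) operation" where
  "table_delta T x as =
     (\<Sum>(x', ws, out)\<leftarrow>T. if x' = x \<and> length ws = length as
        then \<Sum>(w, y)\<leftarrow>out. Poly_Mapping.single y
               (scale (prod_list (map2 coefficient (basis_inputs (gen_rid x) ws) as))
                  (elt (gen_lid x) w))
        else 0)
   + (case as of
        [a] \<Rightarrow> Poly_Mapping.single x (scale (coefficient (Idem (gen_rid x)) a) (Idem (gen_lid x)))
      | _ \<Rightarrow> 0)"

definition pairs_P :: "label list list list" where
  "pairs_P = [[[U 1], [U 2]], [[L 2, U 1], [R 2]], [[R 1], [L 1, U 2]]]"

definition table_X :: table where
  "table_X =
     [(Z3, [], [([], Z2)]),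

      (X3, [], [([L 1], X1)]),
      (X5, [], [([U 2], X2)]),
      (X6, [], [([R 2], X2)]),
      (X7, [], [([U 2], X3), ([L 1], X4)]),
      (X8, [], [([], X4)]),
      (X9, [], [([], X5), ([L 2], X6)]),
      (X10, [], [([U 1], X6)]),
      (X11, [], [([R 1], X7), ([U 1], X8)]),
      (X12, [], [([L 2], X10)]),
      (X1, [[R 1], [R 2]], [([R 1], X6)]),
      (X3, [[R 1], [R 2]], [([], X10)]),
      (X7, [[R 1], [R 2]], [([R 2], X12)]),
      (X2, [[L 2], [L 1]], [([L 2], X3)]),
      (X5, [[L 2], [L 1]], [([L 2], X7)]),
      (X6, [[L 2], [L 1]], [([], X7), ([L 1], X8)]),
      (X10, [[L 2], [L 1]], [([L 1], X11)]),
      (X1, [[R 1], [U 2], [L 1]], [([R 1], X7), ([U 1], X8)]),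
      (X3, [[R 1], [U 2], [L 1]], [([L 1], X11)]),
      (X2, [[L 2], [U 1], [R 2]], [([L 2], X10)]),
      (X5, [[L 2], [U 1], [R 2]], [([U 2], X12)]),
      (X6, [[L 2], [U 1], [R 2]], [([R 2], X12)]),

      (Y2, [], [([L 1], Y1)]),
      (Y3, [], [([U 2], Y1)]),
      (Y4, [], [([R 2], Y1)]),
      (Y5, [], [([U 2], Y2), ([L 1], Y3)]),
      (Y6, [], [([], Y3), ([L 2], Y4)]),
      (Y7, [], [([R 2, R 1], Y2), ([U 1], Y4)]),
      (Y8, [], [([R 1], Y5), ([U 1], Y6), ([L 2], Y7)])]
   @ concat [
       [(Y1, pq, [([R 1, U 2], Y2), ([L 2, U 1], Y4)]),
        (Y2, pq, [([L 1, L 2], Y7)]),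
        (Y3, pq, [([R 1, U 2], Y5), ([U 1, U 2], Y6)]),
        (Y4, pq, [([R 2, R 1], Y5), ([R 2, U 1], Y6)]),
        (Y5, pq, [([L 1, U 2], Y8)]),
        (Y7, pq, [([R 2, U 1], Y8)])]. pq \<leftarrow> pairs_P]
   @ [(Y1, [[R 1], [U 2], [L 1]], [([R 1], Y5), ([U 1], Y6)]),
      (Y2, [[R 1], [U 2], [L 1]], [([L 1], Y8)]),
      (Y1, [[L 2], [U 1], [R 2]], [([L 2], Y7)]),
      (Y3, [[L 2], [U 1], [R 2]], [([U 2], Y8)]),
      (Y4, [[L 2], [U 1], [R 2]], [([R 2], Y8)])]
   @ [(Y1, p @ q, [([U 1, U 2], Y8)]). p \<leftarrow> pairs_P, q \<leftarrow> pairs_P]"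

definition table_Xtilde :: table where
  "table_Xtilde =
     [(X3, [], [([L 1], X1)]),
      (X6, [], [([R 2], X2)]),
      (X7, [], [([U 2], X3)]),
      (X10, [], [([U 1], X6)]),
      (X11, [], [([R 1], X7)]),
      (X12, [], [([L 2], X10)]),
      (X1, [[R 1], [R 2]], [([R 1], X6)]),
      (X3, [[R 1], [R 2]], [([], X10)]),
      (X7, [[R 1], [R 2]], [([R 2], X12)]),
      (X2, [[L 2], [L 1]], [([L 2], X3)]),
      (X6, [[L 2], [L 1]], [([], X7)]),
      (X10, [[L 2], [L 1]], [([L 1], X11)]),
      (X1, [[R 1], [U 2], [L 1]], [([R 1], X7)]),
      (X3, [[R 1], [U 2], [L 1]], [([L 1], X11)]),
      (X2, [[L 2], [U 1], [R 2]], [([L 2], X10)]),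
      (X6, [[L 2], [U 1], [R 2]], [([R 2], X12)]),

      (Y2, [], [([L 1], Y1)]),
      (Y4, [], [([R 2], Y1)]),
      (Y5, [], [([U 2], Y2), ([L 1, L 2], Y4)]),
      (Y7, [], [([R 2, R 1], Y2), ([U 1], Y4)]),
      (Y8, [], [([R 1], Y5), ([L 2], Y7)])]
   @ concat [
       [(Y1, pq, [([R 1, U 2], Y2), ([L 2, U 1], Y4)]),
        (Y2, pq, [([L 1, L 2], Y7)]),
        (Y4, pq, [([R 2, R 1], Y5)]),
        (Y5, pq, [([L 1, U 2], Y8)]),
        (Y7, pq, [([R 2, U 1], Y8)])]. pq \<leftarrow> pairs_P]
   @ [(Y1, [[R 1], [U 2], [L 1]], [([R 1], Y5)]),
      (Y2, [[R 1], [U 2], [L 1]], [([L 1], Y8)]),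
      (Y1, [[L 2], [U 1], [R 2]], [([L 2], Y7)]),
      (Y4, [[L 2], [U 1], [R 2]], [([R 2], Y8)])]
   @ [(Y1, p @ q, [([U 1, U 2], Y8)]). p \<leftarrow> pairs_P, q \<leftarrow> pairs_P]"

definition table_bimodule :: "gen set \<Rightarrow> table \<Rightarrow> gen bimodule" where
  "table_bimodule G T =
     \<lparr>gens = G, lid = gen_lid, rid = gen_rid,
      hdeg = (\<lambda>x. type_hdeg (gen_type_of x)), adeg = (\<lambda>x. type_adeg (gen_type_of x)),
      delta = table_delta T\<rparr>"

definition X_DA :: "gen bimodule" where
  "X_DA = table_bimodule UNIV table_X"

definition Xtilde_DA :: "gen bimodule" where
  "Xtilde_DA = table_bimodule
     {Z1, Z4, X1, X2, X3, X6, X7, X10, X11, X12, Y1, Y2, Y4, Y5, Y7, Y8} table_Xtilde"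

end

theory Submission
  imports Defs
begin

text \<open>In \<open>X_DA\<close> the arrows \<open>Z3 \<rightarrow> Z2\<close>, \<open>X8 \<rightarrow> X4\<close>, \<open>X9 \<rightarrow> X5\<close> and \<open>Y6 \<rightarrow> Y3\<close> are labelled by
  idempotents. Cancelling them gives \<open>Xtilde_DA\<close>, and the homological perturbation lemma yields the
  two homotopy equivalences and the homotopy. All of them vanish on a positive number of algebra
  inputs, and the homotopy on \<open>Xtilde_DA\<close> is zero.

  The class of a path in \<open>B(2)\<close> depends only on its initial vertex and its Alexander degree, and
  whether it is zero can be read off from these data. So the coefficient of a basis element in a
  product is a sum over finitely many splittings of its degree, and each structure equation, although
  it quantifies over infinitely many inputs, says that a finite list of monomial terms cancels modulo
  two.\<close>

section \<open>Coefficient functionals on \<open>B(2)\<close>\<close>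

text \<open>The tables are read through \<open>B2.representation\<close>, so nothing can be computed
  before \<open>B2_basis\<close> is known to be a basis. Rewriting words bounds the quotient from
  above. The obstacle is the bound from below: no normal form may collapse. It comes from
  functionals on the path algebra that add up the coefficients of all paths with a given start and
  weight. A product formula makes them vanish on the ideal, and they become the dual basis. The same
  formula turns the multiplication of two inputs into a finite splitting of weights. Apart from the
  units, every arrow of \<open>X_DA\<close> into the target of a cancelled arrow, and every arrow
  out of the source of one, has no algebra input, and no cancelled source reaches a second such
  target. So each perturbation series stops after one correction, and the maps need no higher
  components. The only zigzag between retained generators is \<open>Y5\<close>, \<open>Y3\<close>,
  \<open>Y6\<close>, \<open>Y4\<close>; it creates the output \<open>L 1, L 2\<close> of
  \<open>Y5\<close> in \<open>Xtilde_DA\<close>.\<close>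

type_synonym occupation = "int \<times> int \<times> int"

text \<open>Integers instead of a set: moving along a path becomes the addition of a vector, and the
  final checks become integer arithmetic.\<close>

definition occupation :: "vertex \<Rightarrow> occupation" where
  "occupation x = (of_bool (0 \<in> x), of_bool (1 \<in> x), of_bool (2 \<in> x))"

definition weight :: "label list \<Rightarrow> alexander" where
  "weight ls = sum_list (map label_adeg ls)"

text \<open>An arrow \<open>R i\<close> or \<open>L i\<close> moves one occupied place, while the
  two contributions of \<open>U i\<close> cancel. Whether the result is a vertex is tested in
  \<open>survives\<close>.\<close>

fun shift :: "occupation \<Rightarrow> alexander \<Rightarrow> occupation" where
  "shift (p, q, r) (a, b, c, e) = (p - a + b, q + a - b - c + e, r + c - e)"

text \<open>A path of weight \<open>(a, b, c, e)\<close> starting at a vertex with occupation numbers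
  \<open>(p, q, r)\<close> is nonzero in \<open>B(2)\<close> exactly if \<open>survives\<close> holds. The first three conditions say
  that it can end at a vertex. The rest says that only the empty path survives at the empty set and
  that with a single occupied place the labels of index \<open>1\<close> and \<open>2\<close> do not mix.\<close>

fun survives :: "occupation \<Rightarrow> alexander \<Rightarrow> bool" where
  "survives (p, q, r) (a, b, c, e) \<longleftrightarrow>
     p - a + b \<in> {0, 1} \<and> q + a - b - c + e \<in> {0, 1} \<and> r + c - e \<in> {0, 1} \<and>
     (p + q + r \<ge> 2 \<or> (a = 0 \<and> b = 0 \<and> c = 0 \<and> e = 0) \<or>
      (p + q + r = 1 \<and> (c = 0 \<and> e = 0 \<and> r = 0 \<or> a = 0 \<and> b = 0 \<and> p = 0)))"

lemmas degree_defs = tau1_def beta1_def tau2_def beta2_def zero_prod_def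

lemma weight_simps [simp]:
  "weight [] = 0" "weight (l # ls) = label_adeg l + weight ls"
  "weight (ls @ ms) = weight ls + weight ms"
  by (simp_all add: weight_def)

lemma vertices_cases:
  assumes "x \<in> vertices"
  obtains "x = {}" | "x = vA" | "x = vB" | "x = vC" | "x = vAB" | "x = vAC" | "x = vBC" | "x = vABC"
  using assms by (auto simp: vertices_def Pow_insert)

lemma inj_on_occupation: "inj_on occupation vertices"
proof (rule inj_onI)
  fix x y assume xy: "x \<in> vertices" "y \<in> vertices" "occupation x = occupation y"
  have "k \<in> x \<longleftrightarrow> k \<in> y" for k
  proof (cases "k \<in> {0, 1, 2}")
    case True
    have "0 \<in> x \<longleftrightarrow> 0 \<in> y" "1 \<in> x \<longleftrightarrow> 1 \<in> y" "2 \<in> x \<longleftrightarrow> 2 \<in> y"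
      using xy(3) by (simp_all add: occupation_def of_bool_eq_iff)
    with True show ?thesis by blast
  next
    case False
    with xy(1,2) show ?thesis unfolding vertices_def by blast
  qed
  then show "x = y" by blast
qed

lemma occupation_eq_iff:
  "x \<in> vertices \<Longrightarrow> y \<in> vertices \<Longrightarrow> occupation x = occupation y \<longleftrightarrow> x = y"
  using inj_on_occupation by (auto dest: inj_onD)

lemma Int_doubleton_eq:
  assumes "a \<noteq> b"
  shows "x \<inter> {a, b} = {a} \<longleftrightarrow> a \<in> x \<and> b \<notin> x" "x \<inter> {a, b} = {b} \<longleftrightarrow> a \<notin> x \<and> b \<in> x"
  using assms by auto

lemma occupation_target:
  assumes "has_arrow x l"
  shows "occupation (target x l) = shift (occupation x) (label_adeg l)"
proof (cases l)
  case (R i)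
  then have *: "i \<in> {1, 2}" "x \<inter> {i - 1, i} = {i - 1}" using assms by simp_all
  have "i \<noteq> i - 1" using *(1) by auto
  with *(2) have "i - 1 \<in> x" "i \<notin> x" by (simp_all add: Int_doubleton_eq)
  with *(1) show ?thesis unfolding R occupation_def
    by (elim insertE emptyE) (simp_all add: tau1_def tau2_def)
next
  case (L i)
  then have *: "i \<in> {1, 2}" "x \<inter> {i - 1, i} = {i}" using assms by simp_all
  have "i \<noteq> i - 1" using *(1) by auto
  with *(2) have "i - 1 \<notin> x" "i \<in> x" by (simp_all add: Int_doubleton_eq)
  with *(1) show ?thesis unfolding L occupation_def
    by (elim insertE emptyE) (simp_all add: beta1_def beta2_def)
next
  case (U i)
  then show ?thesis by (simp add: occupation_def tau1_def tau2_def beta1_def beta2_def)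
qed

lemma shift_zero [simp]: "shift u 0 = u"
  by (cases u) (simp add: zero_prod_def)

lemma shift_shift [simp]: "shift (shift u d) d' = shift u (d + d')"
  by (cases u; cases d; cases d') simp

lemma occupation_endpoint:
  "is_path x ls \<Longrightarrow> occupation (endpoint x ls) = shift (occupation x) (weight ls)"
proof (induction ls arbitrary: x)
  case (Cons l ls)
  then show ?case by (simp add: endpoint_def occupation_target)
qed simp

section \<open>Splitting a surviving weight at a vertex\<close>

definition nonneg :: "alexander \<Rightarrow> bool" where
  "nonneg d \<longleftrightarrow> (case d of (a, b, c, e) \<Rightarrow> 0 \<le> a \<and> 0 \<le> b \<and> 0 \<le> c \<and> 0 \<le> e)"

lemma nonneg_weight: "nonneg (weight ls)"
proof (induction ls)
  case (Cons l ls)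
  then show ?case by (cases l) (auto simp: nonneg_def degree_defs split: prod.splits)
qed (simp add: nonneg_def zero_prod_def)

text \<open>\<open>shift\<close> preserves the number of occupied places, and without negative
  coordinates a coordinate that vanishes in the sum vanishes in both parts. Hence a part that mixes
  the indices 1 and 2 would make the whole weight mix them.\<close>

lemma survives_split:
  assumes "nonneg d" "nonneg d'" "survives u (d + d')" "x \<in> vertices" "u = occupation x"
    "y \<in> vertices" "shift u d = occupation y"
  shows "survives u d" "survives (shift u d) d'"
proof -
  obtain p q r where u: "u = (p, q, r)" by (cases u)
  obtain a b c e a' b' c' e' where d: "d = (a, b, c, e)" "d' = (a', b', c', e')"
    by (cases d; cases d')
  obtain p' q' r' where y: "occupation y = (p', q', r')" by (cases "occupation y")
  have y01: "p' \<in> {0,1}" "q' \<in> {0,1}" "r' \<in> {0,1}"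
    using y by (auto simp: occupation_def)
  have eq: "p' = p - a + b" "q' = q + a - b - c + e" "r' = r + c - e"
    using assms(7) by (simp_all add: u d y)
  have s: "p' - a' + b' \<in> {0, 1}" "q' + a' - b' - c' + e' \<in> {0, 1}" "r' + c' - e' \<in> {0, 1}"
    "p + q + r \<ge> 2 \<or> (a + a' = 0 \<and> b + b' = 0 \<and> c + c' = 0 \<and> e + e' = 0) \<or>
      (p + q + r = 1 \<and> (c + c' = 0 \<and> e + e' = 0 \<and> r = 0 \<or> a + a' = 0 \<and> b + b' = 0 \<and> p = 0))"
    using assms(3) unfolding u d eq by (simp_all add: algebra_simps)
  have sum: "p' + q' + r' = p + q + r" by (simp add: eq)
  have nn: "0 \<le> a" "0 \<le> b" "0 \<le> c" "0 \<le> e" "0 \<le> a'" "0 \<le> b'" "0 \<le> c'" "0 \<le> e'"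
    using assms(1,2) by (auto simp: d nonneg_def)
  have z: "s + t = 0 \<longleftrightarrow> s = 0 \<and> t = 0" if "0 \<le> s" "0 \<le> t" for s t :: int
    using that by linarith
  have t: "p + q + r \<ge> 2 \<or> (a = 0 \<and> b = 0 \<and> c = 0 \<and> e = 0) \<or>
      (p + q + r = 1 \<and> (c = 0 \<and> e = 0 \<and> r = 0 \<or> a = 0 \<and> b = 0 \<and> p = 0))"
    using s(4) unfolding z[OF nn(1) nn(5)] z[OF nn(2) nn(6)] z[OF nn(3) nn(7)] z[OF nn(4) nn(8)] by blast
  have t': "p' + q' + r' \<ge> 2 \<or> (a' = 0 \<and> b' = 0 \<and> c' = 0 \<and> e' = 0) \<or>
      (p' + q' + r' = 1 \<and> (c' = 0 \<and> e' = 0 \<and> r' = 0 \<or> a' = 0 \<and> b' = 0 \<and> p' = 0))"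
    using s(4) eq(1,3) unfolding sum z[OF nn(1) nn(5)] z[OF nn(2) nn(6)] z[OF nn(3) nn(7)] z[OF nn(4) nn(8)]
    by (metis add.right_neutral diff_zero)
  show "survives u d"
    using y01 t unfolding u d survives.simps eq[symmetric] by blast
  show "survives (shift u d) d'"
    using s(1-3) t' unfolding u d shift.simps survives.simps eq[symmetric] by blast
qed

text \<open>Paths with the same start and weight are counted together because they become equal in
  \<open>B(2)\<close>; the condition \<open>survives\<close> discards those that become
  zero.\<close>

definition path_coeff :: "occupation \<Rightarrow> alexander \<Rightarrow> path_algebra \<Rightarrow> bit" where
  "path_coeff u d a = (\<Sum>p\<in>Poly_Mapping.keys a.
     if occupation (qstart p) = u \<and> weight (qlabels p) = d \<and> survives u d
     then Poly_Mapping.lookup a p else 0)"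

lemma path_coeff_add: "path_coeff u d (a + b) = path_coeff u d a + path_coeff u d b"
  unfolding path_coeff_def by (rule setsum_keys_plus_distrib) auto

lemma path_coeff_zero [simp]: "path_coeff u d 0 = 0"
  by (simp add: path_coeff_def)

lemma path_coeff_single:
  "path_coeff u d (Poly_Mapping.single p c) =
     (if occupation (qstart p) = u \<and> weight (qlabels p) = d \<and> survives u d then c else 0)"
  by (cases "c = 0") (auto simp: path_coeff_def)

fun subdegrees :: "alexander \<Rightarrow> alexander list" where
  "subdegrees (a, b, c, e) =
     [(a', b', c', e'). a' \<leftarrow> [0..a], b' \<leftarrow> [0..b], c' \<leftarrow> [0..c], e' \<leftarrow> [0..e]]"

text \<open>The outer test carries the zero relations: nonzero paths such as \<open>R 1\<close> and
  \<open>R 2\<close> can have product zero. The filter drops summands with vanishing coefficients,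
  which keeps the lists short.\<close>

definition splittings :: "occupation \<Rightarrow> alexander \<Rightarrow> alexander list" where
  "splittings u d = (if survives u d
     then filter (\<lambda>d'. survives u d' \<and> survives (shift u d') (d - d')) (subdegrees d) else [])"

lemma subdegrees_product:
  "subdegrees (a, b, c, e) =
     List.product [0..a] (List.product [0..b] (List.product [0..c] [0..e]))"
  by (simp add: product_concat_map map_concat comp_def)

lemma set_subdegrees: "set (subdegrees d) = {d'. nonneg d' \<and> nonneg (d - d')}"
  by (cases d) (auto simp: subdegrees_product nonneg_def simp del: subdegrees.simps)

lemma distinct_subdegrees: "distinct (subdegrees d)"
  by (cases d) (simp add: subdegrees_product distinct_product del: subdegrees.simps)

lemma distinct_splittings: "distinct (splittings u d)"
  by (simp add: splittings_def distinct_subdegrees)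

text \<open>By bilinearity both factors may be single paths. Then only the splitting at the weight
  of the first path can contribute, and \<open>survives_split\<close> guarantees that it is listed
  whenever the concatenation survives.\<close>

lemma path_coeff_mult:
  "path_coeff u d (pa_mult a b) =
     (\<Sum>d'\<leftarrow>splittings u d. path_coeff u d' a * path_coeff (shift u d') (d - d') b)"
proof (induction a rule: poly_mapping_add_induct)
  case (single p c)
  show ?case
  proof (induction b rule: poly_mapping_add_induct)
    case (single q c')
    let ?wp = "weight (qlabels p)" and ?wq = "weight (qlabels q)"
    let ?good = "occupation (qstart p) = u \<and> qend p = qstart q \<and> ?wp + ?wq = d \<and> survives u d"
    have end_p: "occupation (qend p) = shift (occupation (qstart p)) ?wp"
      by (simp add: qend_def occupation_endpoint is_path_qpath)
    \<comment> \<open>Composability concerns vertices, but the functionals only see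
      \<open>shift\<close>; injectivity of \<open>occupation\<close> on vertices connects the
      two.\<close>
    have eq: "shift (occupation (qstart p)) ?wp = occupation (qstart q) \<longleftrightarrow> qend p = qstart q"
      by (metis end_p occupation_eq_iff qend_vertices qstart_vertices)
    have good: "?wp \<in> set (splittings u d) \<and> survives u ?wp \<and> survives (shift u ?wp) ?wq" if ?good
    proof -
      have g: "occupation (qstart p) = u" "qend p = qstart q" "?wp + ?wq = d" "survives u d"
        using that by blast+
      have *: "survives u ?wp" "survives (shift u ?wp) ?wq"
        using survives_split[OF nonneg_weight nonneg_weight g(4)[folded g(3)]
            qstart_vertices g(1)[symmetric] qend_vertices end_p[symmetric, unfolded g(1)]] by blast+
      have "d - ?wp = ?wq" using g(3) by auto
      with * g(4) show ?thesis
        by (simp add: splittings_def set_subdegrees nonneg_weight)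
    qed
    have summand: "path_coeff u d' (Poly_Mapping.single p c) *
        path_coeff (shift u d') (d - d') (Poly_Mapping.single q c') =
        (if d' = ?wp then (if ?good then c * c' else 0) else 0)" if "d' \<in> set (splittings u d)" for d'
    proof (cases "d' = ?wp \<and> occupation (qstart p) = u")
      case True
      then have *: "occupation (qstart q) = shift u d' \<longleftrightarrow> qend p = qstart q" using eq by metis
      have **: "?wq = d - d' \<longleftrightarrow> ?wp + ?wq = d" using True by auto
      have "survives u d" "survives u d'" "survives (shift u d') (d - d')"
        using that by (simp_all add: splittings_def split: if_splits)
      then show ?thesis using True unfolding path_coeff_single * ** by simp
    next
      case False
      then show ?thesis unfolding path_coeff_single by auto
    qed
    have "(\<Sum>d'\<leftarrow>splittings u d. path_coeff u d' (Poly_Mapping.single p c) *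
        path_coeff (shift u d') (d - d') (Poly_Mapping.single q c')) =
        (\<Sum>d'\<in>set (splittings u d). if d' = ?wp then (if ?good then c * c' else 0) else 0)"
      unfolding sum_list_distinct_conv_sum_set[OF distinct_splittings]
      by (rule sum.cong[OF refl summand])
    also have "\<dots> = (if ?good then c * c' else 0)"
      unfolding sum.delta[OF finite_set] using good by auto
    also have "\<dots> = path_coeff u d (pa_mult (Poly_Mapping.single p c) (Poly_Mapping.single q c'))"
      by (auto simp: pa_mult_single path_prod_def path_coeff_single)
    finally show ?case by simp
  qed (simp_all only: pa_mult_add_right path_coeff_add distrib_left sum_list_addf pa_mult_zero
      path_coeff_zero mult_zero_right sum_list_0)
qed (simp_all only: pa_mult_add_left path_coeff_add distrib_right sum_list_addf pa_mult_zero
    path_coeff_zero mult_zero_left sum_list_0)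

section \<open>Vanishing of the functionals on the relation ideal\<close>

lemma path_coeff_word:
  "path_coeff u d (pa_word x ls) =
     of_bool (is_path x ls \<and> occupation x = u \<and> weight ls = d \<and> survives u d)"
  by (simp add: pa_word_def path_coeff_single)

lemma has_arrow_U_commute:
  assumes "has_arrow x l" "i \<in> {1, 2}"
  shows "is_path x [U i, l]" "is_path x [l, U i]"
  using assms has_arrow_vertices[OF assms(1)] has_arrow_target[OF assms(1)] by auto

text \<open>\<open>R 1, R 2\<close> is a path only at \<open>vA\<close> and \<open>L 2, L 1\<close>
  only at \<open>vC\<close>, where a single occupied place forbids mixed indices. The last case
  concerns only the empty set and the single place that \<open>U i\<close> does not touch.\<close>

lemma zero_word_not_survives:
  "is_path x [R 1, R 2] \<Longrightarrow> \<not> survives (occupation x) (weight [R 1, R 2])"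
  "is_path x [L 2, L 1] \<Longrightarrow> \<not> survives (occupation x) (weight [L 2, L 1])"
  "x \<in> vertices \<Longrightarrow> i \<in> {1, 2} \<Longrightarrow> x \<inter> {i - 1, i} = {} \<Longrightarrow>
    \<not> survives (occupation x) (weight [U i])"
  subgoal by (frule is_path_vertices, erule vertices_cases)
    (simp_all add: degree_defs occupation_def)
  subgoal by (frule is_path_vertices, erule vertices_cases)
    (simp_all add: degree_defs occupation_def)
  subgoal by (erule vertices_cases) (auto simp: degree_defs occupation_def)
  done

lemma weight_loop: "weight [R i, L i] = weight [U i]" "weight [L i, R i] = weight [U i]"
  by (simp_all add: add.commute)

text \<open>Each relation either identifies two paths with equal start and weight or kills a word
  whose weight does not survive.\<close>

lemma path_coeff_relation:
  assumes "r \<in> relations"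
  shows "path_coeff u d r = 0"
proof -
  have same: "path_coeff u d (pa_word x ls - pa_word x ms) = 0"
    if "is_path x ls" "is_path x ms" "weight ls = weight ms" for x ls ms
    using that by (simp add: pa_diff path_coeff_add path_coeff_word)
  have die: "path_coeff u d (pa_word x ls) = 0"
    if "\<not> survives (occupation x) (weight ls)" for x ls
    using that by (auto simp: path_coeff_word)
  have loop: "is_path x [R i, L i]" "is_path x [U i]" if "has_arrow x (R i)" for x i
    using that has_arrow_target[OF that] has_arrow_vertices[OF that] by (auto simp: vertices_def)
  have loop': "is_path x [L i, R i]" "is_path x [U i]" if "has_arrow x (L i)" for x i
    using that has_arrow_target[OF that] has_arrow_vertices[OF that] by (auto simp: vertices_def)
  show ?thesis
    using assms unfolding relations_def
  proof (elim UnE CollectE exE conjE)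
    fix x i l assume "r = pa_word x [U i, l] - pa_word x [l, U i]" "i \<in> {1, 2}" "has_arrow x l"
    then show ?thesis using has_arrow_U_commute[of x l i] same[of x "[U i, l]" "[l, U i]"] by simp
  next
    fix x i assume "r = pa_word x [R i, L i] - pa_word x [U i]" "has_arrow x (R i)"
    then show ?thesis by (simp only: same[OF loop weight_loop(1)])
  next
    fix x i assume "r = pa_word x [L i, R i] - pa_word x [U i]" "has_arrow x (L i)"
    then show ?thesis by (simp only: same[OF loop' weight_loop(2)])
  next
    fix x assume "r = pa_word x [R 1, R 2]" "is_path x [R 1, R 2]"
    then show ?thesis by (simp only: die zero_word_not_survives(1) not_False_eq_True)
  next
    fix x assume "r = pa_word x [L 2, L 1]" "is_path x [L 2, L 1]"
    then show ?thesis by (simp only: die zero_word_not_survives(2) not_False_eq_True)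
  next
    fix x i assume "r = pa_word x [U i]" "x \<in> vertices" "i \<in> {1, 2}" "x \<inter> {i - 1, i} = {}"
    then show ?thesis by (simp only: die zero_word_not_survives(3) not_False_eq_True)
  qed
qed

text \<open>By the product formula a coefficient of a product is a combination of coefficients of
  either factor, so the common kernel of all the functionals absorbs multiplication on both sides.
  This is why \<open>u\<close> and \<open>d\<close> vary in the induction.\<close>

lemma path_coeff_ideal: "a \<in> relation_ideal \<Longrightarrow> path_coeff u d a = 0"
  by (induction a arbitrary: u d rule: relation_ideal.induct)
     (simp_all add: path_coeff_relation path_coeff_add path_coeff_mult)

lift_definition coeff :: "occupation \<Rightarrow> alexander \<Rightarrow> B2 \<Rightarrow> bit" is path_coeff
proof -
  fix u d a b assume "ideal_rel a b"
  then have "path_coeff u d (a + b) = 0"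
    by (simp add: ideal_rel_def pa_diff path_coeff_ideal)
  then show "path_coeff u d a = path_coeff u d b"
    by (cases "path_coeff u d a"; cases "path_coeff u d b") (simp_all add: path_coeff_add)
qed

section \<open>Normal forms of paths\<close>

lemma coeff_add: "coeff u d (a + b) = coeff u d a + coeff u d b"
  by transfer (rule path_coeff_add)

lemma coeff_zero [simp]: "coeff u d 0 = 0"
  by transfer simp

lemma coeff_mult:
  "coeff u d (a * b) = (\<Sum>d'\<leftarrow>splittings u d. coeff u d' a * coeff (shift u d') (d - d') b)"
  by transfer (rule path_coeff_mult)

lemma elt_eq_0: "\<not> is_path x ls \<Longrightarrow> elt x ls = 0"
  by (simp add: elt_def pa_word_def zero_B2.abs_eq)

lemma coeff_elt:
  "coeff u d (elt x ls) =
     of_bool (is_path x ls \<and> occupation x = u \<and> weight ls = d \<and> survives u d)"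
  by (simp add: elt_def coeff.abs_eq path_coeff_word)

lemma pa_word_mult:
  assumes "is_path x ls"
  shows "pa_mult (pa_word x ls) (pa_word y ms) =
    (if endpoint x ls = y then pa_word x (ls @ ms) else 0)"
proof (cases "is_path y ms")
  case True
  then show ?thesis
    using assms by (auto simp: pa_word_def pa_mult_single path_prod_def concat_path_def is_path_append)
next
  case False
  then show ?thesis using assms by (auto simp: pa_word_def is_path_append)
qed

lemma elt_mult:
  assumes "is_path x ls"
  shows "elt x ls * elt y ms = (if endpoint x ls = y then elt x (ls @ ms) else 0)"
  by (simp add: elt_def times_B2.abs_eq pa_word_mult[OF assms] zero_B2.abs_eq)

lemma elt_append:
  "elt x (ls @ ms) = elt x ls * elt (endpoint x ls) ms"
proof (cases "is_path x ls")
  case True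
  then show ?thesis by (simp add: elt_mult)
next
  case False
  then show ?thesis by (simp add: elt_eq_0 is_path_append)
qed

lemma elt_Cons: "elt x (l # ls) = elt x [l] * elt (target x l) ls"
  using elt_append[of x "[l]" ls] by (simp add: endpoint_def)

lemma abs_B2_eqI: "a - b \<in> relation_ideal \<Longrightarrow> abs_B2 a = abs_B2 b"
  by (simp add: B2.abs_eq_iff ideal_rel_def)

lemma relations_elt:
  "i \<in> {1, 2} \<Longrightarrow> has_arrow x l \<Longrightarrow> elt x [U i, l] = elt x [l, U i]"
  "has_arrow x (R i) \<Longrightarrow> elt x [R i, L i] = elt x [U i]"
  "has_arrow x (L i) \<Longrightarrow> elt x [L i, R i] = elt x [U i]"
  "elt x [R 1, R 2] = 0"
  "elt x [L 2, L 1] = 0"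
  "i \<in> {1, 2} \<Longrightarrow> x \<inter> {i - 1, i} = {} \<Longrightarrow> elt x [U i] = 0"
proof -
  \<comment> \<open>\<open>elt\<close> is zero off paths by convention, so the zero relations hold
    at every \<open>x\<close>.\<close>
  have 0: "elt x ls = 0" if "is_path x ls \<Longrightarrow> pa_word x ls \<in> relations" for ls
  proof (cases "is_path x ls")
    case True
    then show ?thesis
      unfolding elt_def zero_B2.abs_eq
      by (intro abs_B2_eqI) (use that relation_ideal.rel in auto)
  qed (rule elt_eq_0)
  show "elt x [R 1, R 2] = 0" "elt x [L 2, L 1] = 0"
    by (rule 0, unfold relations_def, blast)+
  show "elt x [U i] = 0" if "i \<in> {1, 2}" "x \<inter> {i - 1, i} = {}"
  proof (rule 0)
    assume "is_path x [U i]"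
    then have "x \<in> vertices" by simp
    with that show "pa_word x [U i] \<in> relations" unfolding relations_def by blast
  qed
  show "elt x [U i, l] = elt x [l, U i]" if "i \<in> {1, 2}" "has_arrow x l"
    unfolding elt_def by (intro abs_B2_eqI relation_ideal.rel, unfold relations_def) (use that in blast)
  show "elt x [R i, L i] = elt x [U i]" if "has_arrow x (R i)"
    unfolding elt_def by (intro abs_B2_eqI relation_ideal.rel, unfold relations_def) (use that in blast)
  show "elt x [L i, R i] = elt x [U i]" if "has_arrow x (L i)"
    unfolding elt_def by (intro abs_B2_eqI relation_ideal.rel, unfold relations_def) (use that in blast)
qed

section \<open>Reduction of words to normal forms\<close>

lemma elt_U_commute:
  assumes "i \<in> {1, 2}"
  shows "elt x (U i # ls) = elt x (ls @ [U i])"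
proof (induction ls arbitrary: x)
  case (Cons l ls)
  show ?case
  proof (cases "has_arrow x l")
    case True
    have "elt x (U i # l # ls) = elt x [U i, l] * elt (target x l) ls"
      using elt_append[of x "[U i, l]" ls] by (simp add: endpoint_def)
    also have "\<dots> = elt x [l, U i] * elt (target x l) ls"
      using True assms by (simp only: relations_elt(1))
    also have "\<dots> = elt x [l] * elt (target x l) (U i # ls)"
      using elt_append[of x "[l, U i]" ls] elt_Cons[of x l "U i # ls"] by (simp add: endpoint_def)
    also have "\<dots> = elt x (l # ls @ [U i])"
      unfolding Cons.IH by (simp only: elt_Cons[of x l "ls @ [U i]"])
    finally show ?thesis by simp
  next
    case False
    then show ?thesis by (simp add: elt_eq_0)
  qed
qed simp

lemma elt_Upow_commute:
  assumes "k \<in> {1, 2}"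
  shows "elt x (Upow k i @ ls) = elt x (ls @ Upow k i)"
proof (induction i arbitrary: ls)
  case (Suc i)
  have "elt x (Upow k (Suc i) @ ls) = elt x (U k # (Upow k i @ ls))" by simp
  also have "\<dots> = elt x ((Upow k i @ ls) @ [U k])" by (rule elt_U_commute[OF assms])
  also have "\<dots> = elt x ((ls @ [U k]) @ Upow k i)" using Suc[of "ls @ [U k]"] by simp
  finally show ?case by (simp add: replicate_append_same)
qed simp

text \<open>One shortest word for each vertex that a nonzero path from \<open>x\<close> can
  reach.\<close>

definition U_free :: "vertex \<Rightarrow> label list list" where
  "U_free x = (case (0 \<in> x, 1 \<in> x, 2 \<in> x) of
     (True, False, False) \<Rightarrow> [[], [R 1]]
   | (False, True, False) \<Rightarrow> [[], [L 1], [R 2]]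
   | (False, False, True) \<Rightarrow> [[], [L 2]]
   | (True, True, False) \<Rightarrow> [[], [R 2], [R 2, R 1]]
   | (True, False, True) \<Rightarrow> [[], [L 2], [R 1]]
   | (False, True, True) \<Rightarrow> [[], [L 1], [L 1, L 2]]
   | _ \<Rightarrow> [[]])"

text \<open>The powers of \<open>U\<close> stand in front, so that a further letter on the left only
  affects \<open>p\<close>. In \<open>B2_basis\<close> they stand at the end;
  \<open>elt_Uword_rotate\<close> converts.\<close>

definition Uword :: "nat \<Rightarrow> nat \<Rightarrow> label list \<Rightarrow> label list" where
  "Uword i j p = Upow 1 i @ Upow 2 j @ p"

text \<open>Behind the letter the powers of \<open>U\<close> live at another vertex, so each is
  moved to the far end of the word and from there back to the front.\<close>

lemma elt_Cons_Uword: "elt x (l # Uword i j p) = elt x (Uword i j (l # p))"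
proof -
  have move: "elt y (l # Upow k n @ q) = elt y (Upow k n @ l # q)" if "k \<in> {1, 2}" for y k n q
  proof -
    have "elt y (l # Upow k n @ q) = elt y [l] * elt (target y l) (Upow k n @ q)"
      by (rule elt_Cons)
    also have "\<dots> = elt y [l] * elt (target y l) (q @ Upow k n)"
      by (simp only: elt_Upow_commute[OF that])
    also have "\<dots> = elt y ((l # q) @ Upow k n)"
      by (simp only: elt_Cons[of y l "q @ Upow k n"] append_Cons)
    finally show ?thesis by (simp only: elt_Upow_commute[OF that])
  qed
  have "elt x (l # Uword i j p) = elt x (Upow 1 i @ l # Upow 2 j @ p)"
    unfolding Uword_def by (rule move) simp
  also have "\<dots> = elt x (Upow 1 i) * elt (endpoint x (Upow 1 i)) (l # Upow 2 j @ p)"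
    by (rule elt_append)
  also have "\<dots> = elt x (Upow 1 i) * elt (endpoint x (Upow 1 i)) (Upow 2 j @ l # p)"
    using move[of 2 "endpoint x (Upow 1 i)" j p] by simp
  finally show ?thesis by (simp only: elt_append Uword_def)
qed

lemma elt_Uword_Suc:
  "elt x (Uword (Suc i) j p) = elt x (U 1 # Uword i j p)"
  "elt x (Uword i (Suc j) p) = elt x (U 2 # Uword i j p)"
proof -
  show "elt x (Uword (Suc i) j p) = elt x (U 1 # Uword i j p)" by (simp add: Uword_def)
  show "elt x (Uword i (Suc j) p) = elt x (U 2 # Uword i j p)"
    unfolding elt_Cons_Uword by (simp add: Uword_def replicate_app_Cons_same)
qed

lemma endpoint_Upow [simp]: "endpoint x (Upow k i) = x"
  by (induction i) (simp_all add: endpoint_def)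

lemma is_path_Upow:
  "k \<in> {1, 2} \<Longrightarrow> is_path x (Upow k i) \<longleftrightarrow> x \<in> vertices"
  by (induction i) auto

lemma elt_Uword: "elt x (Uword i j p) = elt x (Upow 1 i) * elt x (Upow 2 j) * elt x p"
  by (simp add: Uword_def elt_append mult.assoc)

lemma U_free_at:
  "U_free {} = [[]]" "U_free vA = [[], [R 1]]" "U_free vB = [[], [L 1], [R 2]]"
  "U_free vC = [[], [L 2]]" "U_free vAB = [[], [R 2], [R 2, R 1]]"
  "U_free vAC = [[], [L 2], [R 1]]" "U_free vBC = [[], [L 1], [L 1, L 2]]" "U_free vABC = [[]]"
  by (simp_all add: U_free_def)

lemma has_arrow_iff:
  "has_arrow x (R 1) \<longleftrightarrow> x \<in> vertices \<and> 0 \<in> x \<and> 1 \<notin> x"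
  "has_arrow x (R 2) \<longleftrightarrow> x \<in> vertices \<and> 1 \<in> x \<and> 2 \<notin> x"
  "has_arrow x (L 1) \<longleftrightarrow> x \<in> vertices \<and> 0 \<notin> x \<and> 1 \<in> x"
  "has_arrow x (L 2) \<longleftrightarrow> x \<in> vertices \<and> 1 \<notin> x \<and> 2 \<in> x"
  using Int_doubleton_eq[of "0::nat" 1 x] Int_doubleton_eq[of "1::nat" 2 x] by simp_all

lemma target_at:
  "target vA (R 1) = vB" "target vB (L 1) = vA" "target vB (R 2) = vC" "target vC (L 2) = vB"
  "target vAB (R 2) = vAC" "target vAC (L 2) = vAB" "target vAC (R 1) = vBC" "target vBC (L 1) = vAC"
  by auto

lemma RL_arrow_cases:
  assumes "has_arrow x l" "\<And>k. l \<noteq> U k"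
  shows "(x, l, target x l) \<in> {(vA, R 1, vB), (vB, L 1, vA), (vB, R 2, vC), (vC, L 2, vB),
    (vAB, R 2, vAC), (vAC, L 2, vAB), (vAC, R 1, vBC), (vBC, L 1, vAC)}"
proof -
  have "l \<in> {R 1, R 2, L 1, L 2}" using assms by (cases l) auto
  then show ?thesis
    using assms(1)
    by (cases rule: vertices_cases[OF has_arrow_vertices[OF assms(1)]];
        elim insertE emptyE; hypsubst)
       (simp_all only: has_arrow_iff target_at insert_iff empty_iff simp_thms zero_neq_one
         one_neq_zero zero_neq_numeral numeral_neq_zero one_eq_numeral_iff numeral_eq_one_iff
         num.distinct prod.inject)
qed

lemma elt_loop:
  "has_arrow x (R i) \<Longrightarrow> target (target x (R i)) (L i) = x \<Longrightarrow>
    elt x (R i # L i # q) = elt x (U i # q)"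
  "has_arrow x (L i) \<Longrightarrow> target (target x (L i)) (R i) = x \<Longrightarrow>
    elt x (L i # R i # q) = elt x (U i # q)"
  using elt_append[of x "[R i, L i]" q] elt_append[of x "[L i, R i]" q] elt_append[of x "[U i]" q]
  by (simp_all add: endpoint_def relations_elt(2,3) del: target.simps(1,2) has_arrow.simps)

lemma elt_zero_prefix: "elt x (R 1 # R 2 # q) = 0" "elt x (L 2 # L 1 # q) = 0"
  using elt_append[of x "[R 1, R 2]" q] elt_append[of x "[L 2, L 1]" q] relations_elt(4,5)[of x]
  by simp_all

text \<open>A new first letter lengthens the shortest word, or closes a loop with the next letter
  and leaves a \<open>U\<close>, or creates one of the two zero products. There are eight arrows and
  at most three words for each.\<close>

lemma U_free_step:
  assumes "has_arrow x l" "p \<in> set (U_free (target x l))" "\<And>k. l \<noteq> U k"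
  shows "l # p \<in> set (U_free x) \<or> elt x (l # p) = 0 \<or>
    (\<exists>k\<in>{1, 2}. \<exists>p'\<in>set (U_free x). elt x (l # p) = elt x (U k # p'))"
proof -
  have loops:
    "\<And>q. elt vA (R 1 # L 1 # q) = elt vA (U 1 # q)" "\<And>q. elt vB (L 1 # R 1 # q) = elt vB (U 1 # q)"
    "\<And>q. elt vB (R 2 # L 2 # q) = elt vB (U 2 # q)" "\<And>q. elt vC (L 2 # R 2 # q) = elt vC (U 2 # q)"
    "\<And>q. elt vAB (R 2 # L 2 # q) = elt vAB (U 2 # q)"
    "\<And>q. elt vAC (L 2 # R 2 # q) = elt vAC (U 2 # q)"
    "\<And>q. elt vAC (R 1 # L 1 # q) = elt vAC (U 1 # q)"
    "\<And>q. elt vBC (L 1 # R 1 # q) = elt vBC (U 1 # q)"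
    by (rule elt_loop; simp only: has_arrow_iff target_at; simp add: vertices_def)+
  obtain y where y: "y = target x l" by blast
  then have "(x, l, y) \<in> {(vA, R 1, vB), (vB, L 1, vA), (vB, R 2, vC), (vC, L 2, vB),
    (vAB, R 2, vAC), (vAC, L 2, vAB), (vAC, R 1, vBC), (vBC, L 1, vAC)}"
    using RL_arrow_cases[OF assms(1,3)] by simp
  then show ?thesis
    using assms(2)[folded y]
    by (elim insertE emptyE Pair_inject; hypsubst)
       (simp_all only: U_free_at set_simps insert_iff empty_iff simp_thms,
        (elim disjE; simp add: loops elt_zero_prefix del: One_nat_def)+)
qed

lemma normal_form:
  assumes "is_path x ls"
  shows "elt x ls = 0 \<or> (\<exists>i j. \<exists>p\<in>set (U_free x). elt x ls = elt x (Uword i j p))"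
  using assms
proof (induction ls arbitrary: x)
  case Nil
  have "elt x [] = elt x (Uword 0 0 [])" "[] \<in> set (U_free x)"
    by (auto simp: Uword_def U_free_def split: prod.splits bool.splits)
  then show ?case by blast
next
  case (Cons l ls)
  have U_step: "\<exists>i' j'. elt x (U k # Uword i j p) = elt x (Uword i' j' p)" if "k \<in> {1, 2}" for k i j p
    using that elt_Uword_Suc[of x i j p] by (metis insertE empty_iff)
  from Cons have "elt (target x l) ls = 0 \<or>
    (\<exists>i j. \<exists>p\<in>set (U_free (target x l)). elt (target x l) ls = elt (target x l) (Uword i j p))"
    by simp
  then show ?case
  proof (elim disjE exE bexE)
    assume "elt (target x l) ls = 0"
    then show ?thesis by (simp add: elt_Cons[of x l ls])
  next
    fix i j p assume p: "p \<in> set (U_free (target x l))"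
      and eq: "elt (target x l) ls = elt (target x l) (Uword i j p)"
    then have step: "elt x (l # ls) = elt x (l # Uword i j p)"
      by (simp only: elt_Cons[of x l ls] elt_Cons[of x l "Uword i j p"])
    show ?thesis
    proof (cases "\<exists>k. l = U k")
      case True
      then obtain k where k: "l = U k" "k \<in> {1, 2}" using Cons.prems by auto
      then show ?thesis using U_step[of k i j p] p step by auto
    next
      case False
      then have "l # p \<in> set (U_free x) \<or> elt x (l # p) = 0 \<or>
        (\<exists>k\<in>{1, 2}. \<exists>p'\<in>set (U_free x). elt x (l # p) = elt x (U k # p'))"
        using Cons.prems p by (intro U_free_step) auto
      moreover have ls: "elt x (l # ls) = elt x (Uword i j (l # p))"
        using step elt_Cons_Uword by simp
      ultimately show ?thesis
      proof (elim disjE bexE)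
        assume "elt x (l # p) = 0"
        then show ?thesis using ls by (simp add: elt_Uword)
      next
        fix k p' assume k: "k \<in> {1, 2}" and p': "p' \<in> set (U_free x)"
          and eq: "elt x (l # p) = elt x (U k # p')"
        have "elt x (l # ls) = elt x (U k # Uword i j p')"
          unfolding ls elt_Cons_Uword by (simp only: elt_Uword eq)
        then show ?thesis using U_step[OF k, of i j p'] p' by auto
      qed (use ls in blast)
    qed
  qed
qed

lemma weight_Uword: "weight (Uword i j p) = (int i, int i, int j, int j) + weight p"
proof -
  have "weight (Upow 1 i) = (int i, int i, 0, 0)" for i
    by (induction i) (auto simp: degree_defs)
  moreover have "weight (Upow 2 j) = (0, 0, int j, int j)" for j
    by (induction j) (auto simp: degree_defs)
  ultimately show ?thesis by (cases "weight p") (simp add: Uword_def)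
qed

section \<open>Which normal forms vanish\<close>

lemma occupation_at:
  "occupation {} = (0, 0, 0)" "occupation vA = (1, 0, 0)" "occupation vB = (0, 1, 0)"
  "occupation vC = (0, 0, 1)" "occupation vAB = (1, 1, 0)" "occupation vAC = (1, 0, 1)"
  "occupation vBC = (0, 1, 1)" "occupation vABC = (1, 1, 1)"
  by (simp_all add: occupation_def)

lemma weight_at:
  "weight [R 1] = (1, 0, 0, 0)" "weight [L 1] = (0, 1, 0, 0)" "weight [R 2] = (0, 0, 1, 0)"
  "weight [L 2] = (0, 0, 0, 1)" "weight [R 2, R 1] = (1, 0, 1, 0)" "weight [L 1, L 2] = (0, 1, 0, 1)"
  "weight [] = (0, 0, 0, 0)"
  by (simp_all add: degree_defs)

lemma elt_Upow_pos:
  assumes "i > 0"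
  shows "elt x (Upow k i) = elt x [U k] * elt x (Upow k (i - 1))"
    "elt x (Upow k i) = elt x (Upow k (i - 1)) * elt x [U k]"
proof -
  obtain n where i: "i = Suc n" using assms by (cases i) auto
  show "elt x (Upow k i) = elt x [U k] * elt x (Upow k (i - 1))"
    using elt_append[of x "[U k]" "Upow k n"] by (simp add: i endpoint_def)
  show "elt x (Upow k i) = elt x (Upow k (i - 1)) * elt x [U k]"
    using elt_append[of x "Upow k n" "[U k]"] by (simp add: i replicate_append_same)
qed

text \<open>With at least two occupied places every normal form survives. At the empty set,
  \<open>vA\<close> and \<open>vC\<close> some \<open>U i\<close> is zero at the starting vertex
  itself. At \<open>vB\<close> neither is, and relations have to be combined.\<close>

lemma elt_Uword_eq_0:
  assumes x: "x \<in> vertices" and p: "p \<in> set (U_free x)"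
    and dies: "\<not> survives (occupation x) (weight (Uword i j p))"
  shows "elt x (Uword i j p) = 0"
proof -
  have comm: "elt y [U k, l] = elt y [l, U k]" if "k \<in> {1, 2}" for y k l
    using elt_U_commute[OF that, of y "[l]"] by simp
  have swap: "elt y (Upow 1 i) * elt y (Upow 2 j) = elt y (Upow 2 j) * elt y (Upow 1 i)" for y
    using elt_Upow_commute[of 1 y i "Upow 2 j"] by (simp add: elt_append)
  have elt_Uword': "elt y (Uword i j q) = elt y (Upow 2 j) * elt y (Upow 1 i) * elt y q" for y q
    unfolding elt_Uword using swap[of y] by (rule arg_cong)
  have zeroU: "elt {} [U 1] = 0" "elt {} [U 2] = 0" "elt vA [U 2] = 0" "elt vC [U 1] = 0"
    by (rule relations_elt(6); simp)+
  have zero1: "elt y (Uword i j q) = 0" if "i > 0" "elt y [U 1] = 0" for y q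
    using elt_Upow_pos(1)[OF that(1), of y 1] that(2) by (simp add: elt_Uword)
  have zero2: "elt y (Uword i j q) = 0" if "j > 0" "elt y [U 2] = 0" for y q
    using elt_Upow_pos(1)[OF that(1), of y 2] that(2) by (simp add: elt_Uword)
  have split2: "elt y [l, l'] = elt y [l] * elt (target y l) [l']" for y l l'
    by (rule elt_Cons)
  have B_arrows: "has_arrow vB (L 1)" "has_arrow vB (R 2)"
    by (simp_all only: has_arrow_iff) (simp_all add: vertices_def)
  \<comment> \<open>At \<open>vB\<close> the product of \<open>U 1\<close> and \<open>U 2\<close> is
    the word \<open>L 1, R 1, R 2, L 2\<close>, which contains the zero product
    \<open>R 1, R 2\<close>.\<close>
  have B1: "elt vB [U 1] = elt vB [L 1] * elt vA [R 1]"
    using relations_elt(3)[OF B_arrows(1)] split2[of vB "L 1" "R 1"] by (simp only: target_at)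
  have B2: "elt vB [U 2] = elt vB [R 2] * elt vC [L 2]"
    using relations_elt(2)[OF B_arrows(2)] split2[of vB "R 2" "L 2"] by (simp only: target_at)
  have "elt vA [R 1] * elt vB [R 2] = 0"
    using split2[of vA "R 1" "R 2"] relations_elt(4)[of vA] by (simp only: target_at)
  then have B12: "elt vB [U 1] * elt vB [U 2] = 0"
    unfolding B1 B2 by (metis mult.assoc mult_zero_left mult_zero_right)
  \<comment> \<open>\<open>U 2\<close> is moved past \<open>L 1\<close> to \<open>vA\<close>, where
    it is zero. \<open>BR\<close> does the same with \<open>U 1\<close>, \<open>R 2\<close> and
    \<open>vC\<close>.\<close>
  have BL: "elt vB [U 2] * elt vB [L 1] = 0"
  proof -
    have "elt vB [U 2] * elt vB [L 1] = elt vB [U 2, L 1]"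
      by (simp only: split2[of vB "U 2" "L 1"] target.simps)
    also have "\<dots> = elt vB [L 1, U 2]" by (rule comm) simp
    also have "\<dots> = 0" by (simp only: split2[of vB "L 1" "U 2"] target_at zeroU mult_zero_right)
    finally show ?thesis .
  qed
  have BR: "elt vB [U 1] * elt vB [R 2] = 0"
  proof -
    have "elt vB [U 1] * elt vB [R 2] = elt vB [U 1, R 2]"
      by (simp only: split2[of vB "U 1" "R 2"] target.simps)
    also have "\<dots> = elt vB [R 2, U 1]" by (rule comm) simp
    also have "\<dots> = 0" by (simp only: split2[of vB "R 2" "U 1"] target_at zeroU mult_zero_right)
    finally show ?thesis .
  qed
  have zeroB: "elt vB (Uword i j q) = 0" if "i > 0 \<and> j > 0 \<or> q = [L 1] \<and> j > 0 \<or> q = [R 2] \<and> i > 0" for q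
    using that
  proof (elim disjE conjE)
    assume "i > 0" "j > 0"
    then show ?thesis
      unfolding elt_Uword elt_Upow_pos(2)[OF \<open>i > 0\<close>, of vB 1] elt_Upow_pos(1)[OF \<open>j > 0\<close>, of vB 2]
      by (metis B12 mult.assoc mult_zero_left mult_zero_right)
  next
    assume "q = [L 1]" "j > 0"
    then show ?thesis
      unfolding elt_Uword elt_Upow_pos(2)[OF \<open>j > 0\<close>, of vB 2]
      by (metis BL mult.assoc mult_zero_right)
  next
    assume "q = [R 2]" "i > 0"
    then show ?thesis
      unfolding elt_Uword' elt_Upow_pos(2)[OF \<open>i > 0\<close>, of vB 1]
      by (metis BR mult.assoc mult_zero_right)
  qed
  show ?thesis
    using x
  proof (cases rule: vertices_cases)
    case 1
    then have "i > 0 \<or> j > 0" using p dies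
      by (simp only: U_free_at occupation_at weight_Uword) (auto simp: weight_at)
    then show ?thesis using zero1 zero2 zeroU 1 by blast
  next
    case 2
    then have "j > 0" using p dies
      by (simp only: U_free_at occupation_at weight_Uword) (auto simp: weight_at simp del: weight_simps One_nat_def)
    then show ?thesis using zero2 zeroU 2 by blast
  next
    case 3
    then have "i > 0 \<and> j > 0 \<or> p = [L 1] \<and> j > 0 \<or> p = [R 2] \<and> i > 0" using p dies
      by (simp only: U_free_at occupation_at weight_Uword) (auto simp: weight_at simp del: weight_simps One_nat_def)
    then show ?thesis using zeroB 3 by blast
  next
    case 4
    then have "i > 0" using p dies
      by (simp only: U_free_at occupation_at weight_Uword) (auto simp: weight_at simp del: weight_simps One_nat_def)
    then show ?thesis using zero1 zeroU 4 by blast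
  next
    case 5
    then have False using p dies
      by (simp only: U_free_at occupation_at weight_Uword) (auto simp: weight_at simp del: weight_simps One_nat_def)
    then show ?thesis ..
  next
    case 6
    then have False using p dies
      by (simp only: U_free_at occupation_at weight_Uword) (auto simp: weight_at simp del: weight_simps One_nat_def)
    then show ?thesis ..
  next
    case 7
    then have False using p dies
      by (simp only: U_free_at occupation_at weight_Uword) (auto simp: weight_at simp del: weight_simps One_nat_def)
    then show ?thesis ..
  next
    case 8
    then have False using p dies
      by (simp only: U_free_at occupation_at weight_Uword) (auto simp: weight_at simp del: weight_simps One_nat_def)
    then show ?thesis ..
  qed
qed

text \<open>The differences of the \<open>\<tau>\<close> and \<open>\<beta>\<close> coordinates do
  not see the powers of \<open>U\<close>, and they separate the words in \<open>U_free x\<close>.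
  Once \<open>p\<close> is known, the weight gives \<open>i\<close> and \<open>j\<close>.\<close>

lemma Uword_weight_inj:
  assumes "x \<in> vertices" "p \<in> set (U_free x)" "p' \<in> set (U_free x)"
    "weight (Uword i j p) = weight (Uword i' j' p')"
  shows "i = i' \<and> j = j' \<and> p = p'"
  using assms(1)
proof (cases rule: vertices_cases)
qed (use assms(2-4) in \<open>simp only: U_free_at weight_Uword,
  auto simp: weight_at simp del: weight_simps One_nat_def; presburger\<close>)+

lemma survives_iff_elt_neq_0:
  assumes "is_path x ls"
  shows "survives (occupation x) (weight ls) \<longleftrightarrow> elt x ls \<noteq> 0"
proof
  assume "survives (occupation x) (weight ls)"
  then show "elt x ls \<noteq> 0" 
    using coeff_elt[of "occupation x" "weight ls" x ls] assms by auto
next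
  assume nz: "elt x ls \<noteq> 0"
  then obtain i j p where p: "p \<in> set (U_free x)" and eq: "elt x ls = elt x (Uword i j p)"
    using normal_form[OF assms] by auto
  then have s: "survives (occupation x) (weight (Uword i j p))"
    using elt_Uword_eq_0[OF is_path_vertices[OF assms] p] nz by auto
  moreover have "is_path x (Uword i j p)" using elt_eq_0 eq nz by metis
  \<comment> \<open>Equal classes do not by themselves have equal weights. The functional at the
    weight of the normal form is 1 on this class, which forces \<open>ls\<close> to have that
    weight.\<close>
  ultimately have "coeff (occupation x) (weight (Uword i j p)) (elt x ls) = 1"
    unfolding eq coeff_elt by simp
  then have "weight ls = weight (Uword i j p)"
    unfolding coeff_elt by (simp split: if_splits)
  with s show "survives (occupation x) (weight ls)" by simp
qed

lemma normal_form_survives: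
  assumes "is_path x ls" "survives (occupation x) (weight ls)"
  obtains i j p where "p \<in> set (U_free x)" "elt x ls = elt x (Uword i j p)"
    "is_path x (Uword i j p)" "weight ls = weight (Uword i j p)"
proof -
  have nz: "elt x ls \<noteq> 0" using assms survives_iff_elt_neq_0 by blast
  then obtain i j p where p: "p \<in> set (U_free x)" and eq: "elt x ls = elt x (Uword i j p)"
    using normal_form[OF assms(1)] by auto
  have path: "is_path x (Uword i j p)" using elt_eq_0 eq nz by metis
  have "coeff (occupation x) (weight ls) (elt x (Uword i j p)) = 1"
    unfolding eq[symmetric] coeff_elt using assms by simp
  then have "weight ls = weight (Uword i j p)"
    unfolding coeff_elt by (simp split: if_splits)
  with p eq path show ?thesis using that by blast
qed

text \<open>Words that do not survive are both zero; surviving words have normal forms of the same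
  weight, and these coincide by \<open>Uword_weight_inj\<close>.\<close>

lemma elt_eqI:
  assumes "is_path x ls" "is_path x ms" "weight ls = weight ms"
  shows "elt x ls = elt x ms"
proof (cases "survives (occupation x) (weight ls)")
  case True
  then show ?thesis
    using normal_form_survives[OF assms(1)] normal_form_survives[OF assms(2)] assms(3)
      Uword_weight_inj[OF is_path_vertices[OF assms(1)]] by metis
next
  case False
  then show ?thesis
    using assms survives_iff_elt_neq_0 by metis
qed

section \<open>The basis of \<open>B(2)\<close>\<close>

lemma is_path_U_free:
  assumes "x \<in> vertices" "p \<in> set (U_free x)"
  shows "is_path x p"
proof -
  have v: "vA \<in> vertices" "vB \<in> vertices" "vC \<in> vertices" "vAB \<in> vertices" "vAC \<in> vertices"
    "vBC \<in> vertices" "vABC \<in> vertices" "{} \<in> vertices"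
    by (simp_all add: vertices_def)
  show ?thesis
    using assms(2)
    by (cases rule: vertices_cases[OF assms(1)]; hypsubst;
        simp only: U_free_at set_simps insert_iff empty_iff simp_thms;
        (elim disjE)?; simp only: is_path.simps has_arrow_iff target_at v; simp)
qed

lemma elt_Uword_rotate: "elt x (Uword i j p) = elt x (p @ Upow 1 i @ Upow 2 j)"
  using elt_Upow_commute[of 1 x i "Upow 2 j @ p"] elt_Upow_commute[of 2 x j "p @ Upow 1 i"]
  by (simp add: Uword_def del: One_nat_def)

lemma is_path_Uword:
  assumes "x \<in> vertices" "p \<in> set (U_free x)"
  shows "is_path x (Uword i j p)"
  using assms by (simp add: Uword_def is_path_append is_path_Upow is_path_U_free del: One_nat_def)

lemma survives_at:
  "survives (occupation {}) (weight (Uword i j [])) \<longleftrightarrow> i = 0 \<and> j = 0"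
  "survives (occupation vA) (weight (Uword i j [])) \<longleftrightarrow> j = 0"
  "survives (occupation vA) (weight (Uword i j [R 1])) \<longleftrightarrow> j = 0"
  "survives (occupation vB) (weight (Uword i j [])) \<longleftrightarrow> i = 0 \<or> j = 0"
  "survives (occupation vB) (weight (Uword i j [L 1])) \<longleftrightarrow> j = 0"
  "survives (occupation vB) (weight (Uword i j [R 2])) \<longleftrightarrow> i = 0"
  "survives (occupation vC) (weight (Uword i j [])) \<longleftrightarrow> i = 0"
  "survives (occupation vC) (weight (Uword i j [L 2])) \<longleftrightarrow> i = 0"
  "survives (occupation vAB) (weight (Uword i j []))"
  "survives (occupation vAB) (weight (Uword i j [R 2]))"
  "survives (occupation vAB) (weight (Uword i j [R 2, R 1]))"
  "survives (occupation vAC) (weight (Uword i j []))"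
  "survives (occupation vAC) (weight (Uword i j [L 2]))"
  "survives (occupation vAC) (weight (Uword i j [R 1]))"
  "survives (occupation vBC) (weight (Uword i j []))"
  "survives (occupation vBC) (weight (Uword i j [L 1]))"
  "survives (occupation vBC) (weight (Uword i j [L 1, L 2]))"
  "survives (occupation vABC) (weight (Uword i j []))"
  by (simp_all only: weight_Uword weight_at occupation_at, auto)

definition normal_words :: "(vertex \<times> nat \<times> nat \<times> label list) set" where
  "normal_words = {(x, i, j, p). x \<in> vertices \<and> p \<in> set (U_free x) \<and>
     survives (occupation x) (weight (Uword i j p))}"

text \<open>The conditions in \<open>survives_at\<close> are the bounds on exponents in the given
  basis. At \<open>vB\<close>, where one exponent must vanish, that basis lists the idempotent and
  the positive powers of each \<open>U i\<close> separately.\<close>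

lemma B2_basis_eq: "B2_basis = {elt x (Uword i j p) | x i j p. (x, i, j, p) \<in> normal_words}"
proof
  have v: "vA \<in> vertices" "vB \<in> vertices" "vC \<in> vertices" "vAB \<in> vertices" "vAC \<in> vertices"
    "vBC \<in> vertices" "vABC \<in> vertices" "{} \<in> vertices"
    by (simp_all add: vertices_def)
  have nw: "elt x (p @ Upow 1 i @ Upow 2 j) \<in> {elt x (Uword i j p) | x i j p. (x, i, j, p) \<in> normal_words}"
    if "x \<in> vertices" "p \<in> set (U_free x)" "survives (occupation x) (weight (Uword i j p))" for x i j p
    unfolding elt_Uword_rotate[symmetric] normal_words_def using that by blast
  show "B2_basis \<subseteq> {elt x (Uword i j p) | x i j p. (x, i, j, p) \<in> normal_words}"
  proof
    fix b assume "b \<in> B2_basis"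
    then show "b \<in> {elt x (Uword i j p) | x i j p. (x, i, j, p) \<in> normal_words}"
      unfolding B2_basis_def
    proof (elim UnE)
      assume "b \<in> {Idem {}}"
      then show ?thesis using nw[of "{}" "[]" 0 0] v by (simp add: Idem_def survives_at U_free_at del: One_nat_def)
    next
      assume "b \<in> {elt vA (Upow 1 i) | i. True}"
      then show ?thesis using nw[of vA "[]" _ 0] v by (auto simp add: survives_at U_free_at simp del: One_nat_def)
    next
      assume "b \<in> {elt vA (R 1 # Upow 1 i) | i. True}"
      then show ?thesis using nw[of vA "[R 1]" _ 0] v by (auto simp add: survives_at U_free_at simp del: One_nat_def)
    next
      assume "b \<in> {elt vB (L 1 # Upow 1 i) | i. True}"
      then show ?thesis using nw[of vB "[L 1]" _ 0] v by (auto simp add: survives_at U_free_at simp del: One_nat_def)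
    next
      assume "b \<in> {Idem vB}"
      then show ?thesis using nw[of vB "[]" 0 0] v by (simp add: Idem_def survives_at U_free_at del: One_nat_def)
    next
      assume "b \<in> {elt vB (Upow 1 (i + 1)) | i. True}"
      then obtain i where "b = elt vB (Upow 1 (i + 1))" by blast
      then show ?thesis using nw[of vB "[]" "i + 1" 0] v by (simp add: survives_at U_free_at del: One_nat_def replicate_Suc)
    next
      assume "b \<in> {elt vB (Upow 2 (i + 1)) | i. True}"
      then obtain i where "b = elt vB (Upow 2 (i + 1))" by blast
      then show ?thesis using nw[of vB "[]" 0 "i + 1"] v by (simp add: survives_at U_free_at del: One_nat_def replicate_Suc)
    next
      assume "b \<in> {elt vB (R 2 # Upow 2 i) | i. True}"
      then show ?thesis using nw[of vB "[R 2]" 0] v by (auto simp add: survives_at U_free_at simp del: One_nat_def)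
    next
      assume "b \<in> {elt vC (L 2 # Upow 2 i) | i. True}"
      then show ?thesis using nw[of vC "[L 2]" 0] v by (auto simp add: survives_at U_free_at simp del: One_nat_def)
    next
      assume "b \<in> {elt vC (Upow 2 i) | i. True}"
      then show ?thesis using nw[of vC "[]" 0] v by (auto simp add: survives_at U_free_at simp del: One_nat_def)
    next
      assume "b \<in> {elt x (p @ Upow 1 i @ Upow 2 j) | x p i j. (x, p) \<in>
        {(vAB, []), (vAC, []), (vBC, []), (vAB, [R 2]), (vAB, [R 2, R 1]), (vAC, [L 2]),
         (vAC, [R 1]), (vBC, [L 1, L 2]), (vBC, [L 1])}}"
      then obtain x p i j where b: "b = elt x (p @ Upow 1 i @ Upow 2 j)" and xp: "(x, p) \<in>
        {(vAB, []), (vAC, []), (vBC, []), (vAB, [R 2]), (vAB, [R 2, R 1]), (vAC, [L 2]),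
         (vAC, [R 1]), (vBC, [L 1, L 2]), (vBC, [L 1])}" by blast
      show ?thesis
        unfolding b using xp
        by (elim insertE emptyE Pair_inject; hypsubst; intro nw)
           (simp_all only: v survives_at U_free_at, simp_all)
    next
      assume "b \<in> {elt vABC (Upow 1 i @ Upow 2 j) | i j. True}"
      then show ?thesis using nw[of vABC "[]"] v by (auto simp add: survives_at U_free_at simp del: One_nat_def)
    qed
  qed
  have k1: "Idem {} \<in> B2_basis" "elt vA (Upow 1 i) \<in> B2_basis" "elt vA (R 1 # Upow 1 i) \<in> B2_basis"
    "elt vB (L 1 # Upow 1 i) \<in> B2_basis" "Idem vB \<in> B2_basis" "elt vB (Upow 1 (i + 1)) \<in> B2_basis"
    "elt vB (Upow 2 (i + 1)) \<in> B2_basis" "elt vB (R 2 # Upow 2 i) \<in> B2_basis"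
    "elt vC (L 2 # Upow 2 i) \<in> B2_basis" "elt vC (Upow 2 i) \<in> B2_basis" for i
    unfolding B2_basis_def by blast+
  have k2: "elt x (p @ Upow 1 i @ Upow 2 j) \<in> B2_basis" if "(x, p) \<in>
        {(vAB, []), (vAC, []), (vBC, []), (vAB, [R 2]), (vAB, [R 2, R 1]), (vAC, [L 2]),
         (vAC, [R 1]), (vBC, [L 1, L 2]), (vBC, [L 1])}" for x p i j
    unfolding B2_basis_def by (rule UnI1, rule UnI2, rule CollectI, intro exI conjI, rule refl, rule that)
  have k3: "elt vABC (Upow 1 i @ Upow 2 j) \<in> B2_basis" for i j
    unfolding B2_basis_def by blast
  have pos: "n \<noteq> 0 \<Longrightarrow> \<exists>m. n = m + 1" for n :: nat by presburger
  show "{elt x (Uword i j p) | x i j p. (x, i, j, p) \<in> normal_words} \<subseteq> B2_basis"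
  proof (clarify, unfold normal_words_def elt_Uword_rotate, clarify)
    fix x i j p
    assume "x \<in> vertices" and p: "p \<in> set (U_free x)"
      and s: "survives (occupation x) (weight (Uword i j p))"
    from this(1) show "elt x (p @ Upow 1 i @ Upow 2 j) \<in> B2_basis"
    proof (cases rule: vertices_cases)
      case 1
      then show ?thesis using p s k1 by (simp add: U_free_at survives_at Idem_def)
    next
      case 2
      then show ?thesis using p s k1 by (auto simp add: U_free_at survives_at simp del: One_nat_def)
    next
      case 3
      have "elt vB (Upow 1 n) \<in> B2_basis" "elt vB (Upow 2 n) \<in> B2_basis" for n
        by (cases "n = 0"; use pos[of n] k1(5-7) in \<open>auto simp: Idem_def simp del: One_nat_def replicate_Suc\<close>)+
      then show ?thesis using 3 p s k1
        by (auto simp add: U_free_at survives_at Idem_def simp del: One_nat_def)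
    next
      case 4
      then show ?thesis using p s k1 by (auto simp add: U_free_at survives_at simp del: One_nat_def)
    next
      case 5
      show ?thesis by (rule k2) (use p in \<open>auto simp: U_free_at 5 simp del: One_nat_def\<close>)
    next
      case 6
      show ?thesis by (rule k2) (use p in \<open>auto simp: U_free_at 6 simp del: One_nat_def\<close>)
    next
      case 7
      show ?thesis by (rule k2) (use p in \<open>auto simp: U_free_at 7 simp del: One_nat_def\<close>)
    next
      case 8
      then show ?thesis using p k3 by (simp add: U_free_at del: One_nat_def)
    qed
  qed
qed

lemma elt_in_B2_basis:
  assumes "is_path x ls" "survives (occupation x) (weight ls)"
  shows "elt x ls \<in> B2_basis"
  using normal_form_survives[OF assms] is_path_vertices[OF assms(1)] assms
  unfolding B2_basis_eq normal_words_def mem_Collect_eq case_prod_conv by metis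

lemma B2_basis_elt:
  assumes "b \<in> B2_basis"
  obtains x ls where "b = elt x ls" "is_path x ls" "survives (occupation x) (weight ls)"
  using assms is_path_Uword unfolding B2_basis_eq normal_words_def by blast

lemma B2_add_induct [case_names zero elt add]:
  assumes "P 0" "\<And>x ls. is_path x ls \<Longrightarrow> P (elt x ls)" "\<And>a b. P a \<Longrightarrow> P b \<Longrightarrow> P (a + b)"
  shows "P a"
proof -
  have "P (abs_B2 a)" for a
  proof (induction a rule: poly_mapping_add_induct)
    case zero
    then show ?case using assms(1) by (simp add: zero_B2.abs_eq)
  next
    case (single p c)
    have "abs_B2 (Poly_Mapping.single p c) = (if c = 0 then 0 else elt (qstart p) (qlabels p))"
      using is_path_qpath[of p] by (cases c) (simp_all add: elt_def pa_word_def zero_B2.abs_eq)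
    then show ?case using assms(1,2) is_path_qpath by simp
  next
    case (add a b)
    then show ?case using assms(3) by (simp add: plus_B2.abs_eq[symmetric])
  qed
  then show ?thesis by (metis Quotient3_abs_rep Quotient3_B2)
qed

lemma coeff_sum: "coeff u d (sum f S) = (\<Sum>s\<in>S. coeff u d (f s))"
  by (induction S rule: infinite_finite_induct) (simp_all only: sum.infinite sum.empty sum.insert coeff_zero coeff_add simp_thms)

lemma coeff_scale: "coeff u d (scale c a) = c * coeff u d a"
  by (simp add: scale_def)

text \<open>Duality of functionals and basis: a functional that detects a basis element fixes its
  start and weight, hence by \<open>elt_eqI\<close> the element.\<close>

lemma B2_basis_coeff:
  assumes "is_path x w" "survives (occupation x) (weight w)" "b \<in> B2_basis"
  shows "coeff (occupation x) (weight w) b = of_bool (b = elt x w)"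
proof -
  obtain y ls where b: "b = elt y ls" "is_path y ls" "survives (occupation y) (weight ls)"
    using B2_basis_elt[OF assms(3)] .
  have "elt y ls = elt x w" if "coeff (occupation x) (weight w) (elt y ls) = 1"
  proof -
    have "occupation y = occupation x" "weight ls = weight w"
      using that unfolding coeff_elt by (simp_all split: if_splits)
    moreover from this(1) have "y = x"
      using is_path_vertices[OF b(2)] is_path_vertices[OF assms(1)] occupation_eq_iff by blast
    ultimately show ?thesis using elt_eqI b(2) assms(1) by blast
  qed
  moreover have "coeff (occupation x) (weight w) (elt x w) = 1"
    using assms by (simp add: coeff_elt)
  ultimately show ?thesis
    unfolding b(1) by (cases "coeff (occupation x) (weight w) (elt y ls)") auto
qed

lemma independent_B2_basis: "B2.independent B2_basis"
  unfolding B2.independent_explicit_module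
proof (intro allI impI)
  fix t u v assume t: "finite t" "t \<subseteq> B2_basis" "(\<Sum>v\<in>t. scale (u v) v) = 0" and v: "v \<in> t"
  obtain x w where w: "v = elt x w" "is_path x w" "survives (occupation x) (weight w)"
    using B2_basis_elt v t(2) by blast
  have "0 = coeff (occupation x) (weight w) (\<Sum>b\<in>t. scale (u b) b)" using t(3) by simp
  also have "\<dots> = (\<Sum>b\<in>t. if b = v then u b else 0)"
    unfolding coeff_sum coeff_scale
    by (rule sum.cong) (use B2_basis_coeff[OF w(2,3)] w(1) t(2) in auto)
  also have "\<dots> = u v" using t(1) v by (simp add: sum.delta)
  finally show "u v = 0" by simp
qed

lemma span_B2_basis: "B2.span B2_basis = UNIV"
proof -
  have "a \<in> B2.span B2_basis" for a
  proof (induction a rule: B2_add_induct)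
    case (elt x ls)
    then show ?case
      using elt_in_B2_basis survives_iff_elt_neq_0 B2.span_base B2.span_zero by metis
  qed (auto intro: B2.span_zero B2.span_add)
  then show ?thesis by auto
qed

text \<open>Replaces the coefficient used by the tables with a functional that has a product
  formula.\<close>

lemma coefficient_eq_coeff:
  assumes "is_path x w" "survives (occupation x) (weight w)"
  shows "coefficient (elt x w) a = coeff (occupation x) (weight w) a"
proof -
  have span: "a \<in> B2.span B2_basis" for a by (simp add: span_B2_basis)
  have "a = (\<Sum>b | B2.representation B2_basis a b \<noteq> 0. scale (B2.representation B2_basis a b) b)"
    using B2.sum_nonzero_representation_eq[OF independent_B2_basis span] by simp
  then have "coeff (occupation x) (weight w) a =
    (\<Sum>b | B2.representation B2_basis a b \<noteq> 0. B2.representation B2_basis a b * coeff (occupation x) (weight w) b)"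
    by (metis (no_types, lifting) coeff_sum coeff_scale sum.cong)
  also have "\<dots> = (\<Sum>b | B2.representation B2_basis a b \<noteq> 0.
      if b = elt x w then B2.representation B2_basis a b else 0)"
    by (rule sum.cong) (use B2_basis_coeff[OF assms] B2.representation_ne_zero in auto)
  also have "\<dots> = B2.representation B2_basis a (elt x w)"
    by (subst sum.delta[OF B2.finite_representation]) auto
  finally show ?thesis by (simp add: coefficient_def)
qed

section \<open>Operations given by lists of monomial terms\<close>

text \<open>The class of any path of the given weight, with the junk value \<open>0\<close> if there is no path.\<close>

definition monomial :: "occupation \<Rightarrow> alexander \<Rightarrow> B2" where
  "monomial u d = (if \<exists>x ls. is_path x ls \<and> occupation x = u \<and> weight ls = d
     then SOME b. \<exists>x ls. is_path x ls \<and> occupation x = u \<and> weight ls = d \<and> b = elt x ls else 0)"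

lemma monomial_path:
  assumes "is_path x ls"
  shows "monomial (occupation x) (weight ls) = elt x ls"
proof -
  have "b = elt x ls"
    if "is_path y ms" "occupation y = occupation x" "weight ms = weight ls" "b = elt y ms" for y ms b
    using that assms elt_eqI is_path_vertices occupation_eq_iff by metis
  then have "(SOME b. \<exists>y ms. is_path y ms \<and> occupation y = occupation x \<and> weight ms = weight ls \<and>
      b = elt y ms) = elt x ls"
    using assms by (intro some_equality) blast+
  then show ?thesis using assms unfolding monomial_def by auto
qed

lemma monomial_eq_0:
  assumes "\<not> survives u d"
  shows "monomial u d = 0"
proof (cases "\<exists>x ls. is_path x ls \<and> occupation x = u \<and> weight ls = d")
  case True
  then obtain x ls where "is_path x ls" "occupation x = u" "weight ls = d" by blast
  then show ?thesis using monomial_path survives_iff_elt_neq_0 assms by metis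
next
  case False
  then show ?thesis unfolding monomial_def by (rule if_not_P)
qed

lemma elt_mult_Idem:
  "is_path x ls \<Longrightarrow> v \<in> vertices \<Longrightarrow> elt x ls * Idem v = (if endpoint x ls = v then elt x ls else 0)"
  by (simp add: Idem_def elt_mult)

lemma Idem_mult_elt:
  "v \<in> vertices \<Longrightarrow> Idem v * elt x ls = (if v = x then elt x ls else 0)"
  by (simp add: Idem_def elt_mult)

text \<open>Start and weight determine the endpoint, so an idempotent on the right keeps or kills a
  coefficient as a whole.\<close>

lemma coeff_mult_Idem:
  assumes "v \<in> vertices"
  shows "coeff u d (a * Idem v) = (if shift u d = occupation v then coeff u d a else 0)"
proof (induction a rule: B2_add_induct)
  case (elt x ls)
  have "endpoint x ls = v \<longleftrightarrow> shift (occupation x) (weight ls) = occupation v"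
    using occupation_endpoint[OF elt] occupation_eq_iff[OF is_path_endpoint[OF elt] assms] by simp
  then show ?case
    using elt by (auto simp: elt_mult_Idem[OF elt assms] coeff_elt)
qed (simp_all only: distrib_right coeff_add mult_zero_left coeff_zero add_0 split: if_split, simp_all)

lemma coeff_Idem_mult:
  assumes "v \<in> vertices"
  shows "coeff u d (Idem v * a) = (if u = occupation v then coeff u d a else 0)"
proof (induction a rule: B2_add_induct)
  case (elt x ls)
  have "v = x \<longleftrightarrow> occupation v = occupation x"
    using occupation_eq_iff[OF assms is_path_vertices[OF elt]] by simp
  then show ?case
    by (auto simp: Idem_mult_elt[OF assms] coeff_elt)
qed (simp_all only: distrib_left coeff_add mult_zero_right coeff_zero add_0 split: if_split, simp_all)

lemma homogeneous_coeff:
  assumes "homogeneous v a" "coeff u d a \<noteq> 0"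
  shows "d = v"
proof -
  obtain p where p: "abs_B2 p = a" "\<forall>q\<in>Poly_Mapping.keys p. weight (qlabels q) = v"
    using assms(1) unfolding homogeneous_def weight_def by blast
  have "path_coeff u d p \<noteq> 0" using assms(2) p(1) by (auto simp: coeff.abs_eq)
  then show ?thesis
    unfolding path_coeff_def
    by (rule contrapos_np) (use p(2) in \<open>auto intro!: sum.neutral\<close>)
qed

lemma homogeneous_zero: "homogeneous v 0"
  unfolding homogeneous_def by (rule exI[of _ 0]) (simp add: zero_B2.abs_eq)

lemma homogeneous_add:
  assumes "homogeneous v a" "homogeneous v b"
  shows "homogeneous v (a + b)"
proof -
  obtain p q where "abs_B2 p = a" "abs_B2 q = b"
    "\<forall>r\<in>Poly_Mapping.keys p. weight (qlabels r) = v" "\<forall>r\<in>Poly_Mapping.keys q. weight (qlabels r) = v"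
    using assms unfolding homogeneous_def weight_def by blast
  then show ?thesis
    using keys_add[of p q] unfolding homogeneous_def weight_def[symmetric]
    by (intro exI[of _ "p + q"]) (auto simp: plus_B2.abs_eq[symmetric])
qed

lemma homogeneous_elt:
  assumes "is_path x ls"
  shows "homogeneous (weight ls) (elt x ls)"
  unfolding homogeneous_def weight_def[symmetric] elt_def pa_word_def
  using assms by (intro exI[of _ "Poly_Mapping.single (mk_path x ls) 1"]) simp

lemma homogeneous_monomial: "homogeneous d (monomial u d)"
proof (cases "\<exists>x ls. is_path x ls \<and> occupation x = u \<and> weight ls = d")
  case True
  then show ?thesis using monomial_path homogeneous_elt by metis
next
  case False
  then have "monomial u d = 0" unfolding monomial_def by (rule if_not_P)
  then show ?thesis by (simp add: homogeneous_zero)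
qed

lemma homogeneous_scale: "homogeneous v a \<Longrightarrow> homogeneous v (scale c a)"
  by (simp add: scale_def homogeneous_zero)

text \<open>The value 0 for lists of different lengths lets one list of terms hold the operations of
  all indices.\<close>

fun coeffs :: "occupation \<Rightarrow> alexander list \<Rightarrow> B2 list \<Rightarrow> bit" where
  "coeffs u [] [] = 1"
| "coeffs u (d # ds) (a # as) = coeff u d a * coeffs (shift u d) ds as"
| "coeffs u _ _ = 0"

text \<open>The term \<open>(x, ds, d, y)\<close> sends \<open>x\<close>, with basis inputs of weights \<open>ds\<close>, to the monomial of weight
  \<open>d\<close> tensor \<open>y\<close>. The vertices between the inputs are recovered by \<open>shift\<close>.\<close>

type_synonym monomial_term = "gen \<times> alexander list \<times> alexander \<times> gen"

fun term_value :: "monomial_term \<Rightarrow> (gen, gen) operation" where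
  "term_value (x', ds, d, y) x as = (if x' = x then Poly_Mapping.single y
     (scale (coeffs (occupation (gen_rid x)) ds as) (monomial (occupation (gen_lid x)) d)) else 0)"

definition operation_of :: "monomial_term list \<Rightarrow> (gen, gen) operation" where
  "operation_of T x as = (\<Sum>t\<leftarrow>T. term_value t x as)"

text \<open>The path between the left idempotents places the output in the tensor product and makes
  the outputs of composed terms multiply to a monomial.\<close>

fun well_typed :: "monomial_term \<Rightarrow> bool" where
  "well_typed (x, ds, d, y) \<longleftrightarrow> foldl shift (occupation (gen_rid x)) ds = occupation (gen_rid y) \<and>
     (\<exists>ls. is_path (gen_lid x) ls \<and> weight ls = d \<and> endpoint (gen_lid x) ls = gen_lid y)"

definition compose_terms :: "monomial_term list \<Rightarrow> monomial_term list \<Rightarrow> monomial_term list" where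
  "compose_terms S T =
     [(x, ds @ ds', d + d', z). (x, ds, d, y) \<leftarrow> T, (y', ds', d', z) \<leftarrow> S, y' = y]"

text \<open>Undoes one multiplication: an input of weight \<open>d\<close> becomes two inputs whose
  product can have that weight. Parts of weight 0 are included, which accounts for idempotent
  inputs.\<close>

fun merges :: "occupation \<Rightarrow> alexander list \<Rightarrow> alexander list list" where
  "merges u [] = []"
| "merges u (d # ds) =
     map (\<lambda>d'. d' # (d - d') # ds) (splittings u d) @ map ((#) d) (merges (shift u d) ds)"

definition merge_terms :: "monomial_term list \<Rightarrow> monomial_term list" where
  "merge_terms T = [(x, ds', d, y). (x, ds, d, y) \<leftarrow> T, ds' \<leftarrow> merges (occupation (gen_rid x)) ds]"

fun cancel :: "'a list \<Rightarrow> 'a list" where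
  "cancel [] = []"
| "cancel (t # T) = (let T' = cancel T in if t \<in> set T' then remove1 t T' else t # T')"

fun live :: "monomial_term \<Rightarrow> bool" where
  "live (x, ds, d, y) \<longleftrightarrow> survives (occupation (gen_lid x)) d"

definition flatten :: "table \<Rightarrow> monomial_term list" where
  "flatten T = [(x, map weight ws, weight w, y). (x, ws, out) \<leftarrow> T, (w, y) \<leftarrow> out]"

definition all_gens :: "gen list" where
  "all_gens = [Z1, Z2, Z3, Z4, X1, X2, X3, X4, X5, X6, X7, X8, X9, X10, X11, X12,
     Y1, Y2, Y3, Y4, Y5, Y6, Y7, Y8]"

text \<open>The identity operation on an idempotent input: the idempotent is the basis element of weight
  \<open>0\<close>.\<close>

definition unit_terms :: "gen list \<Rightarrow> monomial_term list" where
  "unit_terms G = map (\<lambda>x. (x, [0], 0, x)) G"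

definition delta_terms :: "table \<Rightarrow> monomial_term list" where
  "delta_terms T = flatten T @ unit_terms all_gens"

lemma gen_vertices: "gen_lid x \<in> vertices" "gen_rid x \<in> vertices"
  by (cases x; simp add: gen_lid_def gen_rid_def vertices_def)+

section \<open>Composition of operations on the level of terms\<close>

lemma lookup_left_mult [simp]:
  "Poly_Mapping.lookup (left_mult b t) y = b * Poly_Mapping.lookup t y"
  by (simp add: left_mult_def Poly_Mapping.map.rep_eq when_def)

lemma left_mult_add: "left_mult (a + b) t = left_mult a t + left_mult b t"
  by (rule poly_mapping_eqI) (simp add: lookup_add distrib_right)

lemma left_mult_add_right: "left_mult b (s + t) = left_mult b s + left_mult b t"
  by (rule poly_mapping_eqI) (simp add: lookup_add distrib_left)

lemma left_mult_zero [simp]: "left_mult 0 t = 0" "left_mult b 0 = 0"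
  by (rule poly_mapping_eqI, simp)+

lemma left_mult_single [simp]:
  "left_mult b (Poly_Mapping.single y c) = Poly_Mapping.single y (b * c)"
  by (rule poly_mapping_eqI) (simp add: lookup_single when_def)

lemma scale_mult: "scale c a * scale c' b = scale (c * c') (a * b)"
  by (cases c; cases c') (simp_all add: scale_def)

lemma sum_single:
  "(\<Sum>j\<in>J. Poly_Mapping.single y (f j)) = Poly_Mapping.single y (\<Sum>j\<in>J. f j)"
  by (induction J rule: infinite_finite_induct) (simp_all add: single_add)

lemma operation_of_simps [simp]:
  "operation_of [] x as = 0"
  "operation_of (t # T) x as = term_value t x as + operation_of T x as"
  "operation_of (S @ T) x as = operation_of S x as + operation_of T x as"
  by (simp_all add: operation_of_def)

lemma operation_of_concat:
  "operation_of (concat Ts) x as = (\<Sum>T\<leftarrow>Ts. operation_of T x as)"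
  by (induction Ts) simp_all

text \<open>The inner sum of \<open>da_comp\<close>, isolated because it is additive in
  \<open>t\<close> although the support over which it runs is not.\<close>

definition bind_tensor :: "('h \<Rightarrow>\<^sub>0 B2) \<Rightarrow> ('h \<Rightarrow> 'k \<Rightarrow>\<^sub>0 B2) \<Rightarrow> ('k \<Rightarrow>\<^sub>0 B2)" where
  "bind_tensor t G = (\<Sum>y\<in>Poly_Mapping.keys t. left_mult (Poly_Mapping.lookup t y) (G y))"

lemma bind_tensor_add: "bind_tensor (s + t) G = bind_tensor s G + bind_tensor t G"
  unfolding bind_tensor_def by (rule setsum_keys_plus_distrib) (simp_all add: left_mult_add)

lemma bind_tensor_zero [simp]: "bind_tensor 0 G = 0"
  by (simp add: bind_tensor_def)

lemma bind_tensor_single [simp]: "bind_tensor (Poly_Mapping.single y b) G = left_mult b (G y)"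
  by (cases "b = 0") (simp_all add: bind_tensor_def)

lemma bind_tensor_sum_list: "bind_tensor (\<Sum>s\<leftarrow>S. f s) G = (\<Sum>s\<leftarrow>S. bind_tensor (f s) G)"
  by (induction S) (simp_all add: bind_tensor_add)

lemma da_comp_bind:
  "da_comp G F x as = (\<Sum>j\<le>length as. bind_tensor (F x (take j as)) (\<lambda>y. G y (drop j as)))"
  by (simp add: da_comp_def bind_tensor_def)

lemma coeffs_length: "length ds \<noteq> length as \<Longrightarrow> coeffs u ds as = 0"
  by (induction u ds as rule: coeffs.induct) auto

text \<open>Only the cut after \<open>length ds\<close> inputs contributes, since
  \<open>coeffs\<close> vanishes on lists of any other length.\<close>

lemma coeffs_append:
  "(\<Sum>j\<le>length as. coeffs u ds (take j as) * coeffs (foldl shift u ds) ds' (drop j as)) =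
     coeffs u (ds @ ds') as"
proof (induction ds arbitrary: u as)
  case Nil
  have "coeffs u [] (take j as) * coeffs u ds' (drop j as) = (if j = 0 then coeffs u ds' as else 0)"
    if "j \<le> length as" for j
    using that by (cases j; cases as) simp_all
  then have "(\<Sum>j\<le>length as. coeffs u [] (take j as) * coeffs u ds' (drop j as)) =
      (\<Sum>j\<le>length as. if j = 0 then coeffs u ds' as else 0)"
    by (intro sum.cong) auto
  then show ?case by (simp add: sum.delta del: mult_bit_eq_and)
next
  case (Cons d ds)
  show ?case
  proof (cases as)
    case (Cons a as')
    have "(\<Sum>j\<le>length as. coeffs u (d # ds) (take j as) * coeffs (foldl shift u (d # ds)) ds' (drop j as)) =
      (\<Sum>j\<le>length as'. coeff u d a *
         (coeffs (shift u d) ds (take j as') * coeffs (foldl shift (shift u d) ds) ds' (drop j as')))"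
      unfolding Cons length_Cons sum.atMost_Suc_shift
      by (simp only: take_0 drop_0 coeffs.simps take_Suc_Cons drop_Suc_Cons foldl_Cons mult_zero_left
        add_0 mult.assoc)
    also have "\<dots> = coeff u d a * coeffs (shift u d) (ds @ ds') as'"
      by (simp only: sum_distrib_left[symmetric] Cons.IH)
    finally show ?thesis by (simp add: Cons)
  qed simp
qed

text \<open>True also when the product is zero, so \<open>compose_terms\<close> may add weights and
  leave dead terms to \<open>live\<close>.\<close>

lemma well_typed_monomial_mult:
  assumes "well_typed (x, ds, d, y)" "well_typed (y, ds', d', z)"
  shows "monomial (occupation (gen_lid x)) d * monomial (occupation (gen_lid y)) d' =
    monomial (occupation (gen_lid x)) (d + d')"
proof -
  obtain ls ms where ls: "is_path (gen_lid x) ls" "weight ls = d" "endpoint (gen_lid x) ls = gen_lid y"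
    and ms: "is_path (gen_lid y) ms" "weight ms = d'"
    using assms by auto
  have "is_path (gen_lid x) (ls @ ms)" using ls ms by (simp add: is_path_append)
  from monomial_path[OF this] show ?thesis
    using monomial_path[OF ls(1)] monomial_path[OF ms(1)] ls ms by (simp add: elt_mult)
qed

lemma da_comp_term:
  assumes "well_typed (x', ds, d, y)" "well_typed (y', ds', d', z)"
  shows "(\<Sum>j\<le>length as. bind_tensor (term_value (x', ds, d, y) x (take j as))
       (\<lambda>y. term_value (y', ds', d', z) y (drop j as))) =
    operation_of (if y' = y then [(x', ds @ ds', d + d', z)] else []) x as"
proof (cases "x' = x \<and> y' = y")
  case True
  let ?u = "occupation (gen_rid x)" and ?m = "monomial (occupation (gen_lid x)) (d + d')"
  have m: "monomial (occupation (gen_lid x)) d * monomial (occupation (gen_lid y)) d' = ?m"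
    using well_typed_monomial_mult assms True by blast
  have u: "occupation (gen_rid y) = foldl shift ?u ds"
    using assms(1) True by simp
  have "(\<Sum>j\<le>length as. bind_tensor (term_value (x', ds, d, y) x (take j as))
       (\<lambda>y. term_value (y', ds', d', z) y (drop j as))) =
     (\<Sum>j\<le>length as. Poly_Mapping.single z
        (scale (coeffs ?u ds (take j as) * coeffs (foldl shift ?u ds) ds' (drop j as)) ?m))"
    using True by (simp only: term_value.simps if_True simp_thms bind_tensor_single left_mult_single
        scale_mult m u)
  also have "\<dots> = Poly_Mapping.single z (scale (coeffs ?u (ds @ ds') as) ?m)"
    by (simp only: sum_single B2.scale_sum_left[symmetric] coeffs_append)
  finally show ?thesis using True by simp
qed auto

lemma sum_list_swap:
  "(\<Sum>s\<leftarrow>S. \<Sum>t\<leftarrow>T. f s t) = (\<Sum>t\<leftarrow>T. \<Sum>s\<leftarrow>S. f s t :: 'a :: comm_monoid_add)"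
  by (induction S) (simp_all add: sum_list_addf)

lemma da_comp_operation_of_all:
  assumes "\<forall>t\<in>set T. well_typed t" "\<forall>s\<in>set S. well_typed s"
  shows "da_comp (operation_of S) (operation_of T) x as = operation_of (compose_terms S T) x as"
proof -
  have "da_comp (operation_of S) (operation_of T) x as =
    (\<Sum>t\<leftarrow>T. \<Sum>s\<leftarrow>S. \<Sum>j\<le>length as. bind_tensor (term_value t x (take j as)) (\<lambda>y. term_value s y (drop j as)))"
  proof -
    have bind_op: "bind_tensor u (\<lambda>y. \<Sum>s\<leftarrow>S. f s y) = (\<Sum>s\<leftarrow>S. bind_tensor u (f s))"
      for u :: "gen \<Rightarrow>\<^sub>0 B2" and f :: "monomial_term \<Rightarrow> gen \<Rightarrow> gen \<Rightarrow>\<^sub>0 B2"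
      by (induction S) (simp_all add: bind_tensor_def left_mult_add_right sum.distrib)
    have swap: "(\<Sum>j\<le>n. \<Sum>t\<leftarrow>L. g j t) = (\<Sum>t\<leftarrow>L. \<Sum>j\<le>n. g j t)"
      for n :: nat and L :: "monomial_term list" and g :: "nat \<Rightarrow> monomial_term \<Rightarrow> gen \<Rightarrow>\<^sub>0 B2"
      by (induction L) (simp_all add: sum.distrib)
    show ?thesis
      unfolding da_comp_bind operation_of_def bind_op
      unfolding bind_tensor_sum_list swap
      by (subst sum_list_swap) (rule refl)
  qed
  also have "\<dots> = (\<Sum>t\<leftarrow>T. \<Sum>s\<leftarrow>S. operation_of
      (case t of (x', ds, d, y) \<Rightarrow> case s of (y', ds', d', z) \<Rightarrow>
         if y' = y then [(x', ds @ ds', d + d', z)] else []) x as)"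
    using assms
    by (intro arg_cong[of _ _ sum_list] map_cong refl) (auto simp: da_comp_term simp del: term_value.simps well_typed.simps)
  also have "\<dots> = operation_of (compose_terms S T) x as"
    unfolding compose_terms_def operation_of_concat
    by (simp add: operation_of_concat comp_def split_def map_concat if_distrib[of "\<lambda>l. operation_of l x as"] cong: if_cong)
  finally show ?thesis .
qed

section \<open>Multiplication of adjacent inputs\<close>

lemma multiply_inputs_simps:
  "multiply_inputs 0 (a # b # as) = (a * b) # as"
  "multiply_inputs (Suc j) (a # as) = a # multiply_inputs j as"
  by (simp_all add: multiply_inputs_def)

text \<open>The product formula for \<open>coeff\<close>, applied to the pair that is multiplied:
  the first pair splits the head weight, the other pairs lie in the tail.\<close>

lemma coeffs_merge:
  "(\<Sum>j<length as - 1. coeffs u ds (multiply_inputs j as)) = (\<Sum>ds'\<leftarrow>merges u ds. coeffs u ds' as)"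
proof (induction ds arbitrary: u as)
  case Nil
  have "length (multiply_inputs j as) \<noteq> length ([] :: alexander list)" for j
    by (simp add: multiply_inputs_def)
  then show ?case by (simp add: coeffs_length)
next
  case (Cons d ds)
  consider "length as \<le> 1" | a b as' where "as = a # b # as'"
    by (metis One_nat_def Suc_leI le_less_linear length_Cons list.exhaust list.size(3) not_less_eq_eq zero_le)
  then show ?case
  proof cases
    case 1
    \<comment> \<open>With fewer than two inputs nothing is multiplied; the right side vanishes as
      well because \<open>merges\<close> only yields lists of length at least two.\<close>
    have "length ds' \<ge> 2" if "ds' \<in> set (merges u ds)" for u ds and ds' :: "alexander list"
      using that by (induction u ds arbitrary: ds' rule: merges.induct) (auto, fastforce)
    then have "coeffs u ds' as = 0" if "ds' \<in> set (merges u (d # ds))" for ds'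
      using that 1 by (intro coeffs_length) (metis Suc_1 not_less_eq_eq)
    then have "map (\<lambda>ds'. coeffs u ds' as) (merges u (d # ds)) = map (\<lambda>ds'. 0) (merges u (d # ds))"
      by (intro map_cong refl)
    then have "(\<Sum>ds'\<leftarrow>merges u (d # ds). coeffs u ds' as) = 0"
      by (simp only: sum_list_0)
    moreover have "{..<length as - 1} = {}" using 1 by auto
    ultimately show ?thesis by (simp only: sum.empty)
  next
    case 2
    have "(\<Sum>j<length as - 1. coeffs u (d # ds) (multiply_inputs j as)) =
      coeff u d (a * b) * coeffs (shift u d) ds as' +
      coeff u d a * (\<Sum>j<length (b # as') - 1. coeffs (shift u d) ds (multiply_inputs j (b # as')))"
      unfolding 2
      by (simp only: length_Cons diff_Suc_1 sum.lessThan_Suc_shift multiply_inputs_simps coeffs.simps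
          sum_distrib_left)
    also have "\<dots> = (\<Sum>d'\<leftarrow>splittings u d. coeff u d' a * coeff (shift u d') (d - d') b) *
        coeffs (shift u d) ds as' +
      coeff u d a * (\<Sum>ds'\<leftarrow>merges (shift u d) ds. coeffs (shift u d) ds' (b # as'))"
      by (simp only: coeff_mult Cons.IH)
    also have "\<dots> = (\<Sum>ds'\<leftarrow>merges u (d # ds). coeffs u ds' as)"
      by (simp add: 2 comp_def sum_list_const_mult[symmetric] sum_list_mult_const[symmetric] mult.assoc
          del: mult_bit_eq_and add_bit_eq_xor)
    finally show ?thesis .
  qed
qed

lemma da_merge_operation_of_all:
  "da_merge (operation_of T) x as = operation_of (merge_terms T) x as"
proof (induction T)
  case (Cons t T)
  obtain x' ds d y where t: "t = (x', ds, d, y)" by (cases t)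
  have "(\<Sum>j<length as - 1. term_value t x (multiply_inputs j as)) =
    operation_of (map (\<lambda>ds'. (x', ds', d, y)) (merges (occupation (gen_rid x')) ds)) x as"
  proof (cases "x' = x")
    case True
    have "operation_of (map (\<lambda>ds'. (x, ds', d, y)) M) x as = Poly_Mapping.single y
        (scale (\<Sum>ds'\<leftarrow>M. coeffs (occupation (gen_rid x)) ds' as) (monomial (occupation (gen_lid x)) d))" for M
      by (induction M) (simp_all add: single_add B2.scale_left_distrib del: add_bit_eq_xor)
    then show ?thesis
      using True by (simp only: t term_value.simps if_True simp_thms sum_single
        B2.scale_sum_left[symmetric] coeffs_merge)
  next
    case False
    have "operation_of (map (\<lambda>ds'. (x', ds', d, y)) M) x as = 0" for M
      using False by (induction M) simp_all
    then show ?thesis using False by (simp add: t)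
  qed
  then show ?case
    using Cons by (simp add: da_merge_def sum.distrib merge_terms_def t)
qed (simp add: da_merge_def merge_terms_def)

section \<open>Cancellation of terms modulo two\<close>

lemma tensor_char_two: "(t :: 'g \<Rightarrow>\<^sub>0 B2) + t = 0"
  by (rule poly_mapping_eqI) (simp add: lookup_add B2_char_two)

lemma operation_of_remove1:
  "t \<in> set T \<Longrightarrow> operation_of T x as = term_value t x as + operation_of (remove1 t T) x as"
  unfolding operation_of_def by (rule sum_list_map_remove1)

lemma operation_of_cancel: "operation_of (cancel T) x as = operation_of T x as"
proof (induction T)
  case (Cons t T)
  have "term_value t x as + (term_value t x as + s) = s" for s
    by (simp only: add.assoc[symmetric] tensor_char_two add_0)
  then show ?case
    using Cons operation_of_remove1[of t "cancel T" x as] by (simp add: Let_def)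
qed simp

lemma operation_of_live: "operation_of (filter live T) x as = operation_of T x as"
proof (induction T)
  case (Cons t T)
  obtain x' ds d y where t: "t = (x', ds, d, y)" by (cases t)
  show ?case using Cons by (auto simp: t monomial_eq_0)
qed simp

text \<open>Restricting to one source generator before composing breaks the final checks into small
  ones.\<close>

definition terms_from :: "gen \<Rightarrow> monomial_term list \<Rightarrow> monomial_term list" where
  "terms_from x T = filter (\<lambda>t. fst t = x) T"

lemma operation_of_terms_from: "operation_of (terms_from x T) x as = operation_of T x as"
  unfolding terms_from_def
proof (induction T)
  case (Cons t T)
  obtain x' ds d y where t: "t = (x', ds, d, y)" by (cases t)
  show ?case using Cons by (auto simp: t)
qed simp

lemma da_comp_operation_of:
  assumes "\<forall>t\<in>set T. well_typed t" "\<forall>s\<in>set S. well_typed s"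
  shows "da_comp (operation_of S) (operation_of T) x as =
    operation_of (compose_terms S (terms_from x T)) x as"
proof -
  have "da_comp (operation_of S) (operation_of T) x as =
      da_comp (operation_of S) (operation_of (terms_from x T)) x as"
    by (simp add: da_comp_def operation_of_terms_from)
  then show ?thesis
    using assms by (simp add: da_comp_operation_of_all terms_from_def)
qed

lemma da_merge_operation_of:
  "da_merge (operation_of T) x as = operation_of (merge_terms (terms_from x T)) x as"
  unfolding da_merge_operation_of_all[symmetric] da_merge_def operation_of_terms_from ..

definition arity :: "monomial_term \<Rightarrow> nat" where
  "arity t = length (fst (snd t))"

text \<open>Sorting by the number of inputs only keeps the rewriting in the final checks fast; no relation
  of the two bimodules involves more than six inputs.\<close>

definition cancels :: "monomial_term list \<Rightarrow> bool" where
  "cancels T \<longleftrightarrow> list_all (\<lambda>t. arity t < 7) T \<and>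
     list_all (\<lambda>n. cancel (filter live (filter (\<lambda>t. arity t = n) T)) = []) [0..<7]"

lemma operation_of_arity:
  "operation_of (filter (\<lambda>t. arity t = length as) T) x as = operation_of T x as"
proof (induction T)
  case (Cons t T)
  obtain x' ds d y where t: "t = (x', ds, d, y)" by (cases t)
  show ?case using Cons by (auto simp: t arity_def coeffs_length)
qed simp

lemma operation_of_cancels:
  assumes "cancels T"
  shows "operation_of T x as = 0"
proof -
  let ?T = "filter (\<lambda>t. arity t = length as) T"
  have "cancel (filter live ?T) = []"
  proof (cases "length as < 7")
    case True
    then show ?thesis using assms by (simp add: cancels_def list_all_iff del: upt_rec_numeral)
  next
    case False
    then have "?T = []" using assms by (auto simp: cancels_def list_all_iff filter_empty_conv)
    then show ?thesis by simp
  qed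
  then show ?thesis
    by (metis operation_of_arity operation_of_cancel operation_of_live operation_of_simps(1))
qed

section \<open>Well-definedness and gradings\<close>

lemma in_tensor_zero: "in_tensor Y 0"
  by (simp add: in_tensor_def)

lemma in_tensor_add: "in_tensor Y s \<Longrightarrow> in_tensor Y t \<Longrightarrow> in_tensor Y (s + t)"
  using keys_add[of s t] by (auto simp: in_tensor_def lookup_add distrib_right)

lemma in_tensor_single:
  "y \<in> gens Y \<Longrightarrow> b * Idem (lid Y y) = b \<Longrightarrow> in_tensor Y (Poly_Mapping.single y b)"
  by (auto simp: in_tensor_def lookup_single when_def)

lemma right_idem_zero [simp]: "right_idem Y 0 v = 0"
  by (simp add: right_idem_def)

lemma right_idem_add: "right_idem Y (s + t) v = right_idem Y s v + right_idem Y t v"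
  unfolding right_idem_def by (rule setsum_keys_plus_distrib) (simp_all add: single_add)

lemma right_idem_single:
  "right_idem Y (Poly_Mapping.single y b) v = (if rid Y y = v then Poly_Mapping.single y b else 0)"
  by (cases "b = 0") (simp_all add: right_idem_def)

lemma scale_mult_left: "scale c a * b = scale c (a * b)"
  by (simp add: scale_def)

lemma scale_mult_right: "a * scale c b = scale c (a * b)"
  by (simp add: scale_def)

lemma coeffs_additive:
  "coeffs u ds (as @ (a + b) # cs) = coeffs u ds (as @ a # cs) + coeffs u ds (as @ b # cs)"
proof (induction as arbitrary: u ds)
  case Nil
  show ?case by (cases ds) (simp_all add: coeff_add distrib_right del: add_bit_eq_xor mult_bit_eq_and)
next
  case (Cons c as)
  then show ?case
    by (cases ds) (simp_all add: distrib_left del: add_bit_eq_xor mult_bit_eq_and)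
qed

lemma coeffs_balanced:
  assumes "v \<in> vertices"
  shows "coeffs u ds (as @ (a * Idem v) # b # cs) = coeffs u ds (as @ a # (Idem v * b) # cs)"
proof (induction as arbitrary: u ds)
  case Nil
  show ?case
  proof (cases ds)
    case (Cons d ds')
    then show ?thesis
      by (cases ds') (simp_all add: coeff_mult_Idem[OF assms] coeff_Idem_mult[OF assms])
  qed simp
next
  case (Cons c as)
  then show ?case by (cases ds) simp_all
qed

lemma coeffs_left_Idem:
  "v \<in> vertices \<Longrightarrow>
    coeffs u ds ((Idem v * a) # cs) = (if u = occupation v then coeffs u ds (a # cs) else 0)"
  by (cases ds) (simp_all add: coeff_Idem_mult)

lemma coeffs_right_Idem:
  assumes "v \<in> vertices"
  shows "coeffs u ds (as @ [a * Idem v]) =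
    (if foldl shift u ds = occupation v then coeffs u ds (as @ [a]) else 0)"
proof (induction as arbitrary: u ds)
  case Nil
  show ?case
  proof (cases ds)
    case (Cons d ds')
    then show ?thesis by (cases ds') (simp_all add: coeff_mult_Idem[OF assms])
  qed simp
next
  case (Cons c as)
  then show ?case by (cases ds) simp_all
qed

text \<open>Homogeneous inputs are seen only by terms with exactly their weights, so preservation of
  the Alexander degree becomes one equation per term.\<close>

lemma coeffs_homogeneous:
  "list_all2 homogeneous vs as \<Longrightarrow> coeffs u ds as \<noteq> 0 \<Longrightarrow> ds = vs"
proof (induction u ds as arbitrary: vs rule: coeffs.induct)
  case (2 u d ds a as)
  then obtain v vs' where vs: "vs = v # vs'" "homogeneous v a" "list_all2 homogeneous vs' as"
    by (auto simp: list_all2_Cons2)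
  have "coeff u d a \<noteq> 0" "coeffs (shift u d) ds as \<noteq> 0"
    using 2(3) unfolding coeffs.simps by (metis mult_zero_left, metis mult_zero_right)
  then show ?case using 2(1) vs homogeneous_coeff by blast
qed auto

lemma well_typed_monomial:
  assumes "well_typed (x, ds, d, y)"
  shows "monomial (occupation (gen_lid x)) d * Idem (gen_lid y) = monomial (occupation (gen_lid x)) d"
    "v \<in> vertices \<Longrightarrow> Idem v * monomial (occupation (gen_lid x)) d =
      (if gen_lid x = v then monomial (occupation (gen_lid x)) d else 0)"
proof -
  obtain ls where ls: "is_path (gen_lid x) ls" "weight ls = d" "endpoint (gen_lid x) ls = gen_lid y"
    using assms by auto
  then have m: "monomial (occupation (gen_lid x)) d = elt (gen_lid x) ls"
    using monomial_path by blast
  show "monomial (occupation (gen_lid x)) d * Idem (gen_lid y) = monomial (occupation (gen_lid x)) d"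
    using ls by (simp add: m elt_mult_Idem gen_vertices)
  show "v \<in> vertices \<Longrightarrow> Idem v * monomial (occupation (gen_lid x)) d =
      (if gen_lid x = v then monomial (occupation (gen_lid x)) d else 0)"
    by (auto simp: m Idem_mult_elt)
qed

text \<open>With \<open>length ds\<close> inputs the index is \<open>length ds + 1\<close>, so the
  shift \<open>k + 1 - i\<close> is \<open>k - length ds\<close>. Membership is an implication
  because \<open>delta_terms\<close> contains the units of all generators, also for
  \<open>Xtilde_DA\<close>.\<close>

definition graded_map :: "int \<Rightarrow> gen list \<Rightarrow> gen list \<Rightarrow> monomial_term list \<Rightarrow> bool" where
  "graded_map k G H T \<longleftrightarrow> list_all (\<lambda>(x, ds, d, y). (x \<in> set G \<longrightarrow> y \<in> set H) \<and>
     type_hdeg (gen_type_of y) = type_hdeg (gen_type_of x) + k - int (length ds) \<and>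
     type_adeg (gen_type_of x) + sum_list ds - type_adeg (gen_type_of y) = d) T"

context
  fixes T :: "monomial_term list" and k :: int and G H :: "gen list" and S S' :: table
  assumes typed: "\<forall>t\<in>set T. well_typed t" and graded: "graded_map k G H T"
begin

text \<open>Reduces a condition on values that is closed under sums to a single term together with
  the typing and grading data of that term.\<close>

lemma operation_of_induct [consumes 1, case_names zero add single]:
  assumes "x \<in> set G" "P 0" "\<And>s t. P s \<Longrightarrow> P t \<Longrightarrow> P (s + t)"
    "\<And>ds d y. well_typed (x, ds, d, y) \<Longrightarrow> y \<in> set H \<Longrightarrow>
      type_hdeg (gen_type_of y) = type_hdeg (gen_type_of x) + k - int (length ds) \<Longrightarrow>
      type_adeg (gen_type_of x) + sum_list ds - type_adeg (gen_type_of y) = d \<Longrightarrow>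
      P (Poly_Mapping.single y
        (scale (coeffs (occupation (gen_rid x)) ds as) (monomial (occupation (gen_lid x)) d)))"
  shows "P (operation_of T x as)"
  using typed graded
proof (induction T)
  case (Cons t T)
  obtain x' ds d y where t: "t = (x', ds, d, y)" by (cases t)
  have "P (operation_of T x as)"
    using Cons by (simp add: graded_map_def)
  moreover have "P (term_value t x as)"
  proof (cases "x' = x")
    case True
    have "P (Poly_Mapping.single y
        (scale (coeffs (occupation (gen_rid x)) ds as) (monomial (occupation (gen_lid x)) d)))"
      by (rule assms(4)) (use Cons.prems assms(1) True in \<open>simp_all add: t graded_map_def del: well_typed.simps\<close>)
    then show ?thesis using True by (simp add: t)
  qed (simp add: t assms(2))
  ultimately show ?case using assms(3) by simp
qed (simp add: assms(2))

lemma operation_of_linear: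
  assumes "\<And>ds. coeffs (occupation (gen_rid x)) ds as =
    coeffs (occupation (gen_rid x)) ds bs + coeffs (occupation (gen_rid x)) ds cs"
  shows "operation_of T x as = operation_of T x bs + operation_of T x cs"
proof (induction T)
  case (Cons t T)
  obtain x' ds d y where t: "t = (x', ds, d, y)" by (cases t)
  have "term_value t x as = term_value t x bs + term_value t x cs"
    by (auto simp: t assms B2.scale_left_distrib single_add simp del: add_bit_eq_xor)
  then show ?case using Cons by (simp add: algebra_simps)
qed simp

lemma da_map_operation_of: "da_map D k (table_bimodule (set G) S) (table_bimodule (set H) S') (operation_of T)"
proof -
  let ?X = "table_bimodule (set G) S" and ?Y = "table_bimodule (set H) S'"
  have sel: "gens ?X = set G" "lid ?X = gen_lid" "rid ?X = gen_rid" "gens ?Y = set H" "lid ?Y = gen_lid"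
    "rid ?Y = gen_rid" "hdeg ?X = (\<lambda>x. type_hdeg (gen_type_of x))" "hdeg ?Y = (\<lambda>x. type_hdeg (gen_type_of x))"
    "adeg ?X = (\<lambda>x. type_adeg (gen_type_of x))" "adeg ?Y = (\<lambda>x. type_adeg (gen_type_of x))"
    by (simp_all add: table_bimodule_def)
  have tensor: "in_tensor ?Y (operation_of T x as)" if "x \<in> set G" for x as
    using that
    by (induction rule: operation_of_induct)
       (simp_all only: in_tensor_zero in_tensor_add in_tensor_single sel scale_mult_left well_typed_monomial(1))
  have additive: "operation_of T x (as @ [a + b] @ cs) =
      operation_of T x (as @ [a] @ cs) + operation_of T x (as @ [b] @ cs)" for x as a b cs
    by (rule operation_of_linear) (simp only: append_Cons append_Nil coeffs_additive)
  have balanced: "operation_of T x (as @ [a * Idem v, b] @ cs) = operation_of T x (as @ [a, Idem v * b] @ cs)"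
    if "v \<in> vertices" for x as a b cs v
  proof -
    have "term_value t x (as @ [a * Idem v, b] @ cs) = term_value t x (as @ [a, Idem v * b] @ cs)" for t
      by (cases t) (simp add: coeffs_balanced[OF that])
    then show ?thesis by (simp only: operation_of_def)
  qed
  have left: "operation_of T x ((Idem v * a) # cs) =
      (if gen_rid x = v then operation_of T x (a # cs) else 0)" if "v \<in> vertices" for x a cs v
  proof -
    have "term_value t x ((Idem v * a) # cs) = (if gen_rid x = v then term_value t x (a # cs) else 0)" for t
      using that by (cases t) (simp add: coeffs_left_Idem occupation_eq_iff gen_vertices)
    then show ?thesis by (simp add: operation_of_def)
  qed
  have left_out: "left_mult (Idem v) (operation_of T x as) =
      (if gen_lid x = v then operation_of T x as else 0)" if "x \<in> set G" "v \<in> vertices" for x as v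
    using that(1)
    by (induction rule: operation_of_induct)
       (auto simp: left_mult_add_right scale_mult_right well_typed_monomial(2)[OF _ that(2)])
  have right0: "right_idem ?Y (operation_of T x []) v = (if gen_rid x = v then operation_of T x [] else 0)"
    if "x \<in> set G" "v \<in> vertices" for x v
    using that(1)
  proof (induction rule: operation_of_induct)
    case (single ds d y)
    then have "gen_rid y = gen_rid x" if "ds = []"
      using that occupation_eq_iff[OF gen_vertices(2) gen_vertices(2)] by auto
    then show ?case by (cases ds) (simp_all add: right_idem_single sel)
  qed (auto simp: right_idem_add)
  have right: "operation_of T x (as @ [a * Idem v]) = right_idem ?Y (operation_of T x (as @ [a])) v"
    if "x \<in> set G" "v \<in> vertices" for x as a v
  proof -
    have "operation_of L x (as @ [a * Idem v]) = right_idem ?Y (operation_of L x (as @ [a])) v"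
      if "\<forall>t\<in>set L. well_typed t" for L
      using that
    proof (induction L)
      case (Cons t L)
      obtain x' ds d y where t: "t = (x', ds, d, y)" by (cases t)
      have "term_value t x (as @ [a * Idem v]) = right_idem ?Y (term_value t x (as @ [a])) v"
      proof (cases "x' = x")
        case True
        have "foldl shift (occupation (gen_rid x)) ds = occupation v \<longleftrightarrow> gen_rid y = v"
          using Cons.prems True occupation_eq_iff[OF gen_vertices(2) \<open>v \<in> vertices\<close>] by (simp add: t)
        then show ?thesis
          using True by (simp add: t coeffs_right_Idem[OF \<open>v \<in> vertices\<close>] right_idem_single sel)
      qed (simp add: t)
      then show ?case using Cons by (simp add: right_idem_add)
    qed simp
    then show ?thesis using typed by blast
  qed
  have hdegs: "\<forall>y\<in>Poly_Mapping.keys (operation_of T x as).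
      type_hdeg (gen_type_of y) = type_hdeg (gen_type_of x) + (k + 1 - (int (length as) + 1))"
    if "x \<in> set G" for x as
    using that
  proof (induction rule: operation_of_induct)
    case (add s t)
    then show ?case using keys_add[of s t] by blast
  next
    case (single ds d y)
    show ?case
    proof (cases "length ds = length as")
      case False
      then show ?thesis by (simp add: coeffs_length)
    qed (use single in simp)
  qed simp
  have adegs: "\<forall>y. homogeneous (type_adeg (gen_type_of x) + sum_list vs - type_adeg (gen_type_of y))
      (Poly_Mapping.lookup (operation_of T x as) y)"
    if "x \<in> set G" "list_all2 homogeneous vs as" for x as vs
    using that(1)
  proof (induction rule: operation_of_induct)
    case (add s t)
    then show ?case by (simp add: lookup_add homogeneous_add)
  next
    case (single ds d y)
    show ?case
    proof (cases "coeffs (occupation (gen_rid x)) ds as = 0")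
      case False
      then have "ds = vs" using coeffs_homogeneous that(2) by blast
      then show ?thesis
        using single(4) homogeneous_scale homogeneous_monomial
        by (auto simp: lookup_single when_def homogeneous_zero)
    qed (simp add: homogeneous_zero)
  qed (simp add: homogeneous_zero)
  show ?thesis
    unfolding da_map_def sel
    apply (intro ballI conjI allI impI)
            apply (rule tensor, assumption)
           apply (rule additive)
          apply (rule balanced, assumption)
         apply (rule left, assumption)
        apply (rule left_out; assumption)
       apply (rule right0; assumption)
      apply (rule right; assumption)
     apply (rule bspec[OF hdegs]; assumption)
    apply (rule spec[OF adegs]; assumption)
    done
qed

end

section \<open>From tables to lists of terms\<close>

fun valid_inputs :: "vertex \<Rightarrow> label list list \<Rightarrow> bool" where
  "valid_inputs v [] \<longleftrightarrow> True"
| "valid_inputs v (w # ws) \<longleftrightarrow>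
     is_path v w \<and> survives (occupation v) (weight w) \<and> valid_inputs (endpoint v w) ws"

definition valid_table :: "table \<Rightarrow> bool" where
  "valid_table T \<longleftrightarrow> list_all (\<lambda>(x, ws, out). valid_inputs (gen_rid x) ws \<and>
     list_all (\<lambda>(w, y). is_path (gen_lid x) w \<and> endpoint (gen_lid x) w = gen_lid y \<and>
       foldl endpoint (gen_rid x) ws = gen_rid y) out) T"

lemma coeffs_basis_inputs:
  "valid_inputs v ws \<Longrightarrow> length ws = length as \<Longrightarrow>
    prod_list (map2 coefficient (basis_inputs v ws) as) = coeffs (occupation v) (map weight ws) as"
proof (induction ws arbitrary: v as)
  case (Cons w ws)
  then obtain a as' where as: "as = a # as'" by (cases as) auto
  show ?case
    using Cons by (simp add: as coefficient_eq_coeff occupation_endpoint del: mult_bit_eq_and)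
qed simp

lemma foldl_shift_inputs:
  "valid_inputs v ws \<Longrightarrow> foldl shift (occupation v) (map weight ws) = occupation (foldl endpoint v ws)"
  by (induction ws arbitrary: v) (simp_all add: occupation_endpoint[symmetric])

lemma flatten_Cons:
  "flatten ((x, ws, out) # T) = map (\<lambda>(w, y). (x, map weight ws, weight w, y)) out @ flatten T"
  by (simp add: flatten_def split_def)

lemma well_typed_flatten:
  assumes "valid_table T"
  shows "\<forall>t\<in>set (flatten T). well_typed t"
  using assms
proof (induction T)
  case (Cons e T)
  obtain x ws out where e: "e = (x, ws, out)" by (cases e)
  have "\<forall>t\<in>set (flatten T). well_typed t"
    using Cons by (simp add: valid_table_def)
  moreover have "well_typed (x, map weight ws, weight w, y)" if "(w, y) \<in> set out" for w y
  proof -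
    have "valid_inputs (gen_rid x) ws" "is_path (gen_lid x) w" "endpoint (gen_lid x) w = gen_lid y"
      "foldl endpoint (gen_rid x) ws = gen_rid y"
      using Cons.prems that by (auto simp: e valid_table_def list_all_iff)
    then show ?thesis using foldl_shift_inputs by auto
  qed
  ultimately show ?case by (auto simp: e flatten_Cons simp del: well_typed.simps)
qed (simp add: flatten_def)

lemma operation_of_flatten:
  assumes "valid_table T"
  shows "operation_of (flatten T) x as = (\<Sum>(x', ws, out)\<leftarrow>T. if x' = x \<and> length ws = length as
        then \<Sum>(w, y)\<leftarrow>out. Poly_Mapping.single y
               (scale (prod_list (map2 coefficient (basis_inputs (gen_rid x) ws) as))
                  (elt (gen_lid x) w))
        else 0)"
  using assms
proof (induction T)
  case (Cons e T)
  obtain x' ws out where e: "e = (x', ws, out)" by (cases e)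
  have valid: "valid_inputs (gen_rid x') ws" "\<forall>(w, y)\<in>set out. is_path (gen_lid x') w"
    using Cons.prems by (auto simp: e valid_table_def list_all_iff)
  have "operation_of (map (\<lambda>(w, y). (x', map weight ws, weight w, y)) out) x as =
    (if x' = x \<and> length ws = length as
        then \<Sum>(w, y)\<leftarrow>out. Poly_Mapping.single y
               (scale (prod_list (map2 coefficient (basis_inputs (gen_rid x) ws) as))
                  (elt (gen_lid x) w))
        else 0)"
    using valid(2)
  proof (induction out)
    case (Cons p out)
    obtain w y where p: "p = (w, y)" by (cases p)
    show ?case
    proof (cases "x' = x \<and> length ws = length as")
      case True
      then show ?thesis
        using Cons valid(1) by (simp add: p coeffs_basis_inputs monomial_path)
    next
      case False
      then have "x' \<noteq> x \<or> coeffs (occupation (gen_rid x)) (map weight ws) as = 0"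
        using coeffs_length[of "map weight ws" as] by auto
      then have "term_value (x', map weight ws, weight w, y) x as = 0" by auto
      then show ?thesis using Cons False by (auto simp: p simp del: term_value.simps)
    qed
  qed simp
  then show ?case
    using Cons by (simp add: e flatten_Cons valid_table_def)
qed (simp add: flatten_def)

text \<open>A generator listed twice would contribute its identity twice, which is zero modulo two;
  hence \<open>distinct G\<close>.\<close>

lemma operation_of_unit_terms:
  assumes "distinct G" "x \<in> set G"
  shows "operation_of (unit_terms G) x as = (case as of
        [a] \<Rightarrow> Poly_Mapping.single x (scale (coefficient (Idem (gen_rid x)) a) (Idem (gen_lid x)))
      | _ \<Rightarrow> 0)"
proof -
  have path: "is_path (gen_lid x) []" "is_path (gen_rid x) []" by (simp_all add: gen_vertices)
  have m: "monomial (occupation (gen_lid x)) 0 = Idem (gen_lid x)"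
    using monomial_path[OF path(1)] by (simp add: Idem_def)
  have "survives (occupation (gen_rid x)) 0"
    by (cases rule: vertices_cases[OF gen_vertices(2)[of x]]) (simp_all add: occupation_at zero_prod_def del: One_nat_def)
  then have c: "coefficient (Idem (gen_rid x)) a = coeff (occupation (gen_rid x)) 0 a" for a
    using coefficient_eq_coeff[OF path(2)] by (simp add: Idem_def)
  have "operation_of (unit_terms G) x as = (if x \<in> set G then term_value (x, [0], 0, x) x as else 0)"
    using assms(1) by (induction G) (auto simp: unit_terms_def)
  then show ?thesis
    using assms(2) by (auto simp: m c split: list.splits)
qed

lemma all_gens: "x \<in> set all_gens" "distinct all_gens"
  by (cases x; simp add: all_gens_def) (simp add: all_gens_def)

lemma table_delta_eq:
  assumes "valid_table T"
  shows "table_delta T = operation_of (delta_terms T)"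
  by (intro ext)
     (simp add: table_delta_def delta_terms_def operation_of_flatten[OF assms] operation_of_unit_terms all_gens)

lemma well_typed_delta_terms:
  assumes "valid_table T"
  shows "\<forall>t\<in>set (delta_terms T). well_typed t"
  using well_typed_flatten[OF assms]
  by (auto simp: delta_terms_def unit_terms_def gen_vertices intro!: exI[of _ "[]"])

section \<open>The homotopy equivalence\<close>

definition tilde_gens :: "gen list" where
  "tilde_gens = [Z1, Z4, X1, X2, X3, X6, X7, X10, X11, X12, Y1, Y2, Y4, Y5, Y7, Y8]"

definition identity_table :: "gen list \<Rightarrow> table" where
  "identity_table G = map (\<lambda>x. (x, [], [([], x)])) G"

text \<open>\<open>X7\<close> and \<open>Y5\<close> are the only retained generators with an arrow
  into a cancelled target, labelled \<open>L 1\<close> and ending at \<open>X4\<close> and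
  \<open>Y3\<close>; the contraction continues to \<open>X8\<close> and \<open>Y6\<close>.\<close>

definition inclusion_table :: table where
  "inclusion_table = identity_table tilde_gens @ [(X7, [], [([L 1], X8)]), (Y5, [], [([L 1], Y6)])]"

text \<open>A cancelled target goes back to its source and leaves along the other arrow of that
  source. Only \<open>X9\<close> and \<open>Y6\<close> have one, with label
  \<open>L 2\<close>.\<close>

definition projection_table :: table where
  "projection_table = identity_table tilde_gens @ [(X5, [], [([L 2], X6)]), (Y3, [], [([L 2], Y4)])]"

text \<open>The four cancelled arrows, reversed.\<close>

definition contraction_table :: table where
  "contraction_table = [(Z2, [], [([], Z3)]), (X4, [], [([], X8)]), (X5, [], [([], X9)]), (Y3, [], [([], Y6)])]"

definition relation_terms :: "monomial_term list \<Rightarrow> gen \<Rightarrow> monomial_term list" where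
  "relation_terms D x = compose_terms D (terms_from x D) @ merge_terms (terms_from x D)"

definition differential_terms ::
  "monomial_term list \<Rightarrow> monomial_term list \<Rightarrow> monomial_term list \<Rightarrow> gen \<Rightarrow> monomial_term list" where
  "differential_terms D D' F x = compose_terms D' (terms_from x F) @ compose_terms F (terms_from x D) @
     merge_terms (terms_from x F)"

definition homotopy_terms :: "gen list \<Rightarrow> monomial_term list \<Rightarrow> monomial_term list \<Rightarrow>
    monomial_term list \<Rightarrow> monomial_term list \<Rightarrow> gen \<Rightarrow> monomial_term list" where
  "homotopy_terms G D P F h x = compose_terms P (terms_from x F) @
     terms_from x (flatten (identity_table G)) @ differential_terms D D h x"

definition cancels_from :: "(gen \<Rightarrow> monomial_term list) \<Rightarrow> bool" where
  "cancels_from T \<longleftrightarrow> list_all (\<lambda>x. cancels (T x)) all_gens"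

lemma operation_of_cancels_from: "cancels_from T \<Longrightarrow> operation_of (T x) x as = 0"
  using operation_of_cancels all_gens(1) by (auto simp: cancels_from_def list_all_iff)

text \<open>Keeps the rewriting from enumerating the power set.\<close>

lemma in_vertices_code [code_unfold]: "x \<in> vertices \<longleftrightarrow> x \<subseteq> {0, 1, 2}"
  by (simp add: vertices_def)

section \<open>Finite verifications\<close>

lemma valid_tables:
  "valid_table table_X" "valid_table table_Xtilde" "valid_table inclusion_table"
  "valid_table projection_table" "valid_table contraction_table"
  "valid_table (identity_table tilde_gens)" "valid_table (identity_table all_gens)"
  by code_simp+

lemma graded_tables:
  "graded_map 1 all_gens all_gens (delta_terms table_X)"
  "graded_map 1 tilde_gens tilde_gens (delta_terms table_Xtilde)"
  "graded_map 0 tilde_gens all_gens (flatten inclusion_table)"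
  "graded_map 0 all_gens tilde_gens (flatten projection_table)"
  "graded_map (-1) all_gens all_gens (flatten contraction_table)"
  "graded_map (-1) tilde_gens tilde_gens (flatten [])"
  by code_simp+

lemma inclusion_closed:
  "cancels_from (differential_terms (delta_terms table_Xtilde) (delta_terms table_X) (flatten inclusion_table))"
  by code_simp

lemma projection_closed:
  "cancels_from (differential_terms (delta_terms table_X) (delta_terms table_Xtilde) (flatten projection_table))"
  by code_simp

text \<open>The corrections in the inclusion end at \<open>X8\<close> and \<open>Y6\<close>, which
  the projection kills, so the composite is the identity on the nose and the empty list serves as
  homotopy.\<close>

lemma projection_inclusion:
  "cancels_from (homotopy_terms tilde_gens (delta_terms table_Xtilde) (flatten projection_table)
     (flatten inclusion_table) (flatten []))"
  by code_simp

text \<open>The corrections match: at \<open>X7\<close> both sides are \<open>L 1\<close> tensor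
  \<open>X8\<close>; at \<open>X5\<close> both are \<open>X5\<close> plus \<open>L 2\<close> tensor
  \<open>X6\<close>, the value of the differential on \<open>X9\<close>.\<close>

lemma inclusion_projection:
  "cancels_from (homotopy_terms all_gens (delta_terms table_X) (flatten inclusion_table)
     (flatten projection_table) (flatten contraction_table))"
  by code_simp

text \<open>Idempotent inputs are covered: compositions with unit terms cancel against splittings
  with a part of weight 0.\<close>

lemma relation_Xtilde: "cancels_from (relation_terms (delta_terms table_Xtilde))"
  by code_simp

lemma relation_X: "cancels_from (relation_terms (delta_terms table_X))"
  by code_simp

lemma da_id_operation_of:
  assumes "distinct G" "x \<in> set G"
  shows "da_id (table_bimodule (set G) T) x as = operation_of (flatten (identity_table G)) x as"
proof -
  have path: "is_path (gen_lid x) []" by (simp add: gen_vertices)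
  have m: "monomial (occupation (gen_lid x)) 0 = Idem (gen_lid x)"
    using monomial_path[OF path] by (simp add: Idem_def)
  have "operation_of (flatten (identity_table G)) x as =
      (if x \<in> set G then term_value (x, [], 0, x) x as else 0)"
    using assms(1) by (induction G) (auto simp: flatten_def identity_table_def)
  then show ?thesis
    using assms(2) by (cases as) (auto simp: m da_id_def table_bimodule_def)
qed

lemma da_bimodule_table:
  assumes "valid_table T" "graded_map 1 G G (delta_terms T)" "cancels_from (relation_terms (delta_terms T))"
  shows "da_bimodule (table_bimodule (set G) T)"
proof -
  let ?D = "delta_terms T"
  have sel: "gens (table_bimodule (set G) T) = set G" "delta (table_bimodule (set G) T) = operation_of ?D"
    "lid (table_bimodule (set G) T) = gen_lid" "rid (table_bimodule (set G) T) = gen_rid"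
    by (simp_all add: table_bimodule_def table_delta_eq[OF assms(1)])
  have "da_comp (operation_of ?D) (operation_of ?D) x as + da_merge (operation_of ?D) x as = 0" for x as
    using operation_of_cancels_from[OF assms(3), of x as] well_typed_delta_terms[OF assms(1)]
    by (simp add: relation_terms_def da_comp_operation_of da_merge_operation_of)
  then show ?thesis
    unfolding da_bimodule_def sel
    using gen_vertices da_map_operation_of[OF well_typed_delta_terms[OF assms(1)] assms(2)] by blast
qed

lemma da_differential_table:
  assumes "valid_table T" "valid_table T'" "valid_table F"
  shows "da_differential (table_bimodule (set G) T) (table_bimodule (set H) T') (operation_of (flatten F)) x as =
    operation_of (differential_terms (delta_terms T) (delta_terms T') (flatten F) x) x as"
  using well_typed_delta_terms[OF assms(1)] well_typed_delta_terms[OF assms(2)] well_typed_flatten[OF assms(3)]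
  by (simp add: da_differential_def table_bimodule_def table_delta_eq assms(1,2) differential_terms_def
      da_comp_operation_of da_merge_operation_of add.assoc)

lemma da_homotopy_table:
  assumes valid: "valid_table T" "valid_table F" "valid_table P" "valid_table h"
    and G: "distinct G" "x \<in> set G"
    and "cancels_from (homotopy_terms G (delta_terms T) (flatten P) (flatten F) (flatten h))"
  shows "da_comp (operation_of (flatten P)) (operation_of (flatten F)) x as + da_id (table_bimodule (set G) T) x as =
    da_differential (table_bimodule (set G) T) (table_bimodule (set G) T) (operation_of (flatten h)) x as"
    (is "?l = ?r")
proof -
  have "?l + ?r = 0"
    using operation_of_cancels_from[OF assms(7), of x as] well_typed_flatten[OF valid(2)]
      well_typed_flatten[OF valid(3)]
    by (simp add: da_comp_operation_of valid da_id_operation_of[OF G] da_differential_table homotopy_terms_def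
        operation_of_terms_from add.assoc)
  \<comment> \<open>The check only shows that the two sides add up to zero; characteristic two turns
    this into equality.\<close>
  have "?l = (?l + ?r) + ?r"
    by (simp only: add.assoc tensor_char_two add_0_right)
  also have "\<dots> = ?r"
    by (simp only: \<open>?l + ?r = 0\<close> add_0)
  finally show ?thesis .
qed

theorem theorem1p2:
  shows "da_bimodule Xtilde_DA \<and> homotopy_equivalent Xtilde_DA X_DA"
proof -
  have "set all_gens = UNIV" using all_gens(1) by blast
  then have X: "X_DA = table_bimodule (set all_gens) table_X"
    by (simp add: X_DA_def)
  have Xt: "Xtilde_DA = table_bimodule (set tilde_gens) table_Xtilde"
    by (simp add: Xtilde_DA_def tilde_gens_def)
  have tilde: "distinct tilde_gens" by (simp add: tilde_gens_def)
  have nil: "valid_table []" by (simp add: valid_table_def)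
  have bimods: "da_bimodule X_DA" "da_bimodule Xtilde_DA"
    unfolding X Xt by (rule da_bimodule_table; rule valid_tables graded_tables relation_X relation_Xtilde)+
  let ?f = "operation_of (flatten inclusion_table)" and ?g = "operation_of (flatten projection_table)"
    and ?h = "operation_of (flatten [])" and ?h' = "operation_of (flatten contraction_table)"
  have "da_morphism 0 Xtilde_DA X_DA ?f" "da_morphism 0 X_DA Xtilde_DA ?g"
    "da_morphism (-1) Xtilde_DA Xtilde_DA ?h" "da_morphism (-1) X_DA X_DA ?h'"
    unfolding da_morphism_def X Xt
    by (rule da_map_operation_of[OF well_typed_flatten]; rule valid_tables nil graded_tables)+
  moreover have "da_differential Xtilde_DA X_DA ?f x as = 0" "da_differential X_DA Xtilde_DA ?g x as = 0" for x as
    unfolding X Xt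
    by (simp_all add: da_differential_table valid_tables operation_of_cancels_from inclusion_closed projection_closed)
  moreover have "da_comp ?g ?f x as + da_id Xtilde_DA x as = da_differential Xtilde_DA Xtilde_DA ?h x as"
    if "x \<in> gens Xtilde_DA" for x as
    unfolding Xt
    by (rule da_homotopy_table) (use that projection_inclusion valid_tables nil tilde in \<open>auto simp: Xt table_bimodule_def\<close>)
  moreover have "da_comp ?f ?g x as + da_id X_DA x as = da_differential X_DA X_DA ?h' x as" for x as
    unfolding X
    by (rule da_homotopy_table) (use inclusion_projection valid_tables all_gens in auto)
  ultimately show ?thesis
    unfolding homotopy_equivalent_def using bimods by blast
qed

end
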